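(* Suppose that there are no resonances, i.e., there is no $0\neq m=(m_1,\dots,m_N)\in\mathbb{Z}^N$ with $\sum_{i=1}^N m_i\omega_i=0$. Consider the evolution of $\rho(t)=\rho(x(t))$ on a time interval $[0,T]$ along a motion $x(t)$ of the system $\dot x=Ax+Bu$ under the basic control $u(x)=-\mathrm{sign}\langle B,\frac{\partial\rho}{\partial x}(x)\rangle$. Let $M=\min\{\rho(0),\rho(T),T\}$. Then, as $M\to+\infty$, $$\frac{\rho(0)-\rho(T)}{T}=1+o(1).$$ Under any other admissible control, $$\frac{\rho(0)-\rho(T)}{T}\le 1+o(1)\quad\text{as } M\to+\infty.$$
   Context: Let $\omega_1,\dots,\omega_N>0$ be pairwise distinct. The state is $x=(x_1,y_1,\dots,x_N,y_N)^*\in\mathbb{R}^{2N}$, and $\dot x=Ax+Bu$ means $\dot x_i=y_i$, $\dot y_i=-\omega_i^2x_i+u$, $i=1,\dots,N$; so $A$ is block diagonal with blocks $\begin{pmatrix}0&1\\-\omega_i^2&0\end{pmatrix}$ and $B=(0,1,\dots,0,1)^*$. Admissible controls are measurable with $|u|\le1$. For $p=(\xi_1,\eta_1,\dots,\xi_N,\eta_N)\in\mathbb{R}^{2N}$ put $z_i=(\eta_i^2+\omega_i^{-2}\xi_i^2)^{1/2}$ and $$H(p)=\frac1{(2\pi)^N}\int_{(\mathbb{R}/2\pi\mathbb{Z})^N}\Big|\sum_{i=1}^N z_i\cos\varphi_i\Big|\,d\varphi_1\cdots d\varphi_N .$$ $H$ is a norm; $\rho(x)=\max_{H(p)\le1}\langle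 x,p\rangle$ is the dual norm, differentiable outside $0$. $\mathrm{sign}$ is the multivalued function $\mathrm{sign}(s)=\pm1$ for $s\gtrless0$, $\mathrm{sign}(0)=[-1,1]$; a motion under the basic control is an absolutely continuous solution of the differential inclusion $\dot x\in Ax+Bu(x)$. The symbol $o(1)$ as $M\to+\infty$ denotes a quantity that is arbitrarily small in absolute value for all motions with $M$ sufficiently large. *)

theory Defs
  imports "HOL-Analysis.Analysis"
begin

text \<open>The phase space of \<open>N\<close> oscillators is \<open>(real \<times> real) ^ 'n\<close> with \<open>N = CARD('n)\<close>: the \<open>i\<close>-th
  component is the pair \<open>(x\<^sub>i, y\<^sub>i)\<close>, and the inner product is the standard one of
  \<open>2N\<close>-dimensional Euclidean space. Covectors \<open>p\<close> have components \<open>(\<xi>\<^sub>i, \<eta>\<^sub>i)\<close>.\<close>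

type_synonym 'n phase = "(real \<times> real) ^ 'n"

definition osc_A :: "real ^ 'n \<Rightarrow> 'n::finite phase \<Rightarrow> 'n phase" where
  "osc_A \<omega> x = (\<chi> i. (snd (x $ i), - (\<omega> $ i)\<^sup>2 * fst (x $ i)))"

definition osc_B :: "'n::finite phase" where
  "osc_B = (\<chi> i. (0, 1))"

definition nonresonant :: "real ^ 'n::finite \<Rightarrow> bool" where
  "nonresonant \<omega> \<longleftrightarrow> \<not> (\<exists>m :: int ^ 'n. m \<noteq> 0 \<and> (\<Sum>i\<in>UNIV. of_int (m $ i) * \<omega> $ i) = 0)"

definition amplitude :: "real ^ 'n \<Rightarrow> 'n::finite phase \<Rightarrow> 'n \<Rightarrow> real" where
  "amplitude \<omega> p i = sqrt ((snd (p $ i))\<^sup>2 + (fst (p $ i))\<^sup>2 / (\<omega> $ i)\<^sup>2)"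

text \<open>The torus is represented by its fundamental domain, the cube \<open>[0, 2\<pi>]\<^sup>N\<close>.\<close>

definition torus_H :: "real ^ 'n \<Rightarrow> 'n::finite phase \<Rightarrow> real" where
  "torus_H \<omega> p = 1 / (2 * pi) ^ CARD('n) *
     (LINT \<phi>:cbox (0 :: real ^ 'n) (\<chi> i. 2 * pi)|lborel.
        \<bar>\<Sum>i\<in>UNIV. amplitude \<omega> p i * cos (\<phi> $ i)\<bar>)"

text \<open>The unit ball of \<^term>\<open>torus_H \<omega>\<close> is nonempty, and compact if all \<open>\<omega>\<^sub>i > 0\<close>, so the supremum
  below is attained.\<close>

definition dual_norm :: "real ^ 'n \<Rightarrow> 'n::finite phase \<Rightarrow> real" where
  "dual_norm \<omega> x = (SUP p\<in>{p. torus_H \<omega> p \<le> 1}. x \<bullet> p)"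

text \<open>Meaningful only where \<open>f\<close> is differentiable.\<close>

definition gradient :: "('a::real_inner \<Rightarrow> real) \<Rightarrow> 'a \<Rightarrow> 'a" where
  "gradient f x = (THE D. GDERIV f x :> D)"

definition sign_set :: "real \<Rightarrow> real set" where
  "sign_set s = (if s > 0 then {1} else if s < 0 then {-1} else {-1..1})"

text \<open>At the origin, where \<open>\<rho>\<close> is not differentiable, every value in \<open>[-1, 1]\<close> is allowed. A motion
  along which \<open>\<rho>\<close> is positive at the final time never meets the origin, because \<open>\<rho>\<close> cannot
  increase under the basic control.\<close>

definition basic_control :: "real ^ 'n \<Rightarrow> 'n::finite phase \<Rightarrow> real set" where
  "basic_control \<omega> x =
     (if x = 0 then {-1..1} else uminus ` sign_set (osc_B \<bullet> gradient (dual_norm \<omega>) x))"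

definition abs_continuous_on :: "real set \<Rightarrow> (real \<Rightarrow> 'a::real_normed_vector) \<Rightarrow> bool" where
  "abs_continuous_on S f \<longleftrightarrow>
     (\<forall>\<epsilon>>0. \<exists>\<delta>>0. \<forall>I :: (real \<times> real) set.
        finite I \<and> (\<forall>(a, b)\<in>I. a \<le> b \<and> {a..b} \<subseteq> S) \<and>
        disjoint_family_on (\<lambda>(a, b). {a<..<b}) I \<and> (\<Sum>(a, b)\<in>I. b - a) < \<delta>
        \<longrightarrow> (\<Sum>(a, b)\<in>I. norm (f b - f a)) < \<epsilon>)"

definition basic_motion :: "real ^ 'n \<Rightarrow> real \<Rightarrow> (real \<Rightarrow> 'n::finite phase) \<Rightarrow> bool" where
  "basic_motion \<omega> T x \<longleftrightarrow> abs_continuous_on {0..T} x \<and>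
     (AE t in lebesgue. t \<in> {0..T} \<longrightarrow>
        (\<exists>v \<in> basic_control \<omega> (x t).
           (x has_vector_derivative (osc_A \<omega> (x t) + v *\<^sub>R osc_B)) (at t)))"

definition admissible_control :: "real \<Rightarrow> (real \<Rightarrow> real) \<Rightarrow> bool" where
  "admissible_control T u \<longleftrightarrow>
     u \<in> borel_measurable (lebesgue_on {0..T}) \<and> (\<forall>t\<in>{0..T}. \<bar>u t\<bar> \<le> 1)"

definition controlled_motion ::
    "real ^ 'n \<Rightarrow> real \<Rightarrow> (real \<Rightarrow> real) \<Rightarrow> (real \<Rightarrow> 'n::finite phase) \<Rightarrow> bool" where
  "controlled_motion \<omega> T u x \<longleftrightarrow> abs_continuous_on {0..T} x \<and>
     (AE t in lebesgue. t \<in> {0..T} \<longrightarrow>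
        (x has_vector_derivative (osc_A \<omega> (x t) + u t *\<^sub>R osc_B)) (at t))"

end

theory Submission
  imports Defs
begin

text \<open>The norm \<open>H\<close> is the torus mean of \<open>\<bar>f\<^sub>p\<bar>\<close>, where
  \<open>f\<^sub>p(\<phi>) = \<Sum>\<^sub>i \<eta>\<^sub>i cos \<phi>\<^sub>i + (\<xi>\<^sub>i / \<omega>\<^sub>i) sin \<phi>\<^sub>i\<close> is linear in \<open>p\<close>. Write \<open>A\<close>, \<open>B\<close> for the data of the
  control system and \<open>A*\<close> for the adjoint of \<open>A\<close>. Then \<open>\<langle>B, exp(s A*) p\<rangle> = f\<^sub>p(s \<omega>)\<close>, so in the
  absence of resonances Weyl's equidistribution theorem says that
  \<open>(1/L) \<integral>\<^sub>0\<^sup>L \<bar>\<langle>B, exp(s A*) p\<rangle>\<bar> ds\<close> tends to \<open>H(p)\<close> as \<open>L \<rightarrow> \<infinity>\<close>, uniformly for bounded \<open>p\<close>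
  (\<open>time_average_uniform_limit\<close>). Both \<open>H\<close> and \<open>\<rho>\<close> are invariant under the free flow.

  For a fixed covector \<open>p\<close> the pairing \<open>\<langle>x(t), exp((c - t) A*) p\<rangle>\<close> has derivative
  \<open>u(t) \<langle>B, exp((c - t) A*) p\<rangle>\<close> almost everywhere; all estimates come from integrating this identity
  (\<open>pairing_increment_ge\<close>), so \<open>\<rho>\<close> is never differentiated along a trajectory.

  Upper bound, for every control bounded by 1: choose \<open>p\<close> with \<open>H(p) \<le> 1\<close> so that the pairing at time
  0 is \<open>\<rho>(x(0))\<close>. At time \<open>T\<close> the pairing is at most \<open>\<rho>(x(T))\<close>, and it has lost at most
  \<open>\<integral>\<^sub>0\<^sup>T \<bar>\<langle>B, exp(s A*) p\<rangle>\<bar> ds \<le> T (1 + o(1))\<close>.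

  Lower bound, for the basic control: the torus mean detects proportionality of the forms \<open>f\<^sub>p\<close>, hence
  the unit ball of \<open>H\<close> is strictly convex (\<open>torus_H_strictly_convex\<close>). So for \<open>x \<noteq> 0\<close> the maximiser
  of \<open>\<langle>x, p\<rangle>\<close> over \<open>H(p) \<le> 1\<close> is unique; it is the gradient of \<open>\<rho>\<close> at \<open>x\<close>, depends continuously on
  \<open>x\<close> and is constant on rays. On a time window \<open>[a, b]\<close> of bounded length on which \<open>x\<close> is large, the
  motion differs from the free motion through \<open>x(b)\<close> by a bounded amount, so the gradient at \<open>x(t)\<close>
  is close to \<open>exp((b - t) A*) p\<close> with \<open>p\<close> the gradient at \<open>x(b)\<close>. The basic control therefore nearly
  minimises the derivative of the pairing, and \<open>\<rho>(x(a)) - \<rho>(x(b)) \<ge> (b - a) (1 - \<epsilon>)\<close>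
  (\<open>steered_window_decrease_ge\<close>). Cutting \<open>[0, T]\<close> into windows and proceeding backwards from \<open>T\<close>, where
  \<open>\<rho>\<close> is large, keeps \<open>\<rho>\<close> large on all windows.\<close>

section \<open>Absolutely continuous functions\<close>

lemma straddle_lower_bound:
  fixes f :: "real \<Rightarrow> real"
  assumes "(f has_real_derivative d) (at t)" "d \<ge> 0" "e > 0"
  obtains r where "r > 0"
    "\<And>u v. u \<le> t \<Longrightarrow> t \<le> v \<Longrightarrow> u \<in> ball t r \<Longrightarrow> v \<in> ball t r \<Longrightarrow> - e * (v - u) \<le> f v - f u"
proof -
  from assms(1) have "(f has_derivative (*) d) (at t)"
    by (simp add: has_field_derivative_def)
  then obtain r where r: "r > 0"
    "\<And>y. norm (y - t) < r \<Longrightarrow> norm (f y - f t - d * (y - t)) \<le> e * norm (y - t)"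
    using \<open>e > 0\<close> unfolding has_derivative_at_alt by blast
  have "- e * (v - u) \<le> f v - f u"
    if "u \<le> t" "t \<le> v" "u \<in> ball t r" "v \<in> ball t r" for u v
  proof -
    have "\<bar>f v - f t - d * (v - t)\<bar> \<le> e * (v - t)" "\<bar>f u - f t - d * (u - t)\<bar> \<le> e * (t - u)"
      using r(2)[of v] r(2)[of u] that by (auto simp: dist_real_def)
    moreover have "d * (v - t) \<ge> 0" "d * (t - u) \<ge> 0"
      using \<open>d \<ge> 0\<close> that by auto
    ultimately show ?thesis by (simp add: algebra_simps)
  qed
  with r(1) show thesis by (rule that)
qed

text \<open>A gauge is chosen so that the intervals of a fine tagged division whose tag lies in the exceptional
  null set have small total length. Absolute continuity bounds their contribution to
  \<open>f b - f a\<close>, and the derivative bounds that of the others.\<close>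

lemma abs_continuous_on_nondecreasing:
  fixes f :: "real \<Rightarrow> real"
  assumes ac: "abs_continuous_on {a..b} f" and "a \<le> b"
    and ae: "AE t in lebesgue. t \<in> {a..b} \<longrightarrow> (\<exists>d\<ge>0. (f has_real_derivative d) (at t))"
  shows "f a \<le> f b"
proof (rule field_le_epsilon)
  fix e :: real assume "e > 0"
  \<comment> \<open>the \<open>+ 1\<close> avoids a division by zero for \<open>a = b\<close>; half of \<open>e\<close> is spent on each kind of tag\<close>
  define e1 where "e1 = e / 2 / (b - a + 1)"
  have "e1 > 0" using \<open>e > 0\<close> \<open>a \<le> b\<close> by (simp add: e1_def)
  have e1: "e1 * (b - a) \<le> e / 2"
    using \<open>e > 0\<close> \<open>a \<le> b\<close> by (simp add: e1_def field_simps)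
  have "e / 2 > 0" using \<open>e > 0\<close> by simp
  then obtain \<delta> where "\<delta> > 0" and \<delta>: "\<And>I :: (real \<times> real) set.
        finite I \<and> (\<forall>(u, v)\<in>I. u \<le> v \<and> {u..v} \<subseteq> {a..b}) \<and>
        disjoint_family_on (\<lambda>(u, v). {u<..<v}) I \<and> (\<Sum>(u, v)\<in>I. v - u) < \<delta>
        \<Longrightarrow> (\<Sum>(u, v)\<in>I. norm (f v - f u)) < e / 2"
    using ac unfolding abs_continuous_on_def by meson
  obtain N where N: "N \<in> null_sets lebesgue"
    and bad: "{t \<in> space lebesgue. \<not> (t \<in> {a..b} \<longrightarrow> (\<exists>d\<ge>0. (f has_real_derivative d) (at t)))} \<subseteq> N"
    using ae unfolding eventually_ae_filter by (elim bexE)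
  have good: "\<exists>d\<ge>0. (f has_real_derivative d) (at t)" if "t \<notin> N" "t \<in> {a..b}" for t
    using bad that by auto
  obtain U where U: "open U" "N \<subseteq> U" "(U - N) \<in> lmeasurable" "emeasure lebesgue (U - N) < ennreal \<delta>"
    using sets_lebesgue_outer_open[of N \<delta>] N \<open>\<delta> > 0\<close> by auto
  have Ulm: "U \<in> lmeasurable"
    using U(2,3) N
    by (metis Diff_partition fmeasurable.Un fmeasurableI_null_sets)
  have Umeas: "measure lebesgue U < \<delta>"
  proof -
    have "emeasure lebesgue U = emeasure lebesgue (U - N)"
      using N Ulm by (simp add: emeasure_Diff_null_set fmeasurableD)
    then show ?thesis
      using U(4) Ulm \<open>\<delta> > 0\<close>
      by (metis emeasure_eq_measure2 ennreal_less_iff measure_nonneg)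
  qed
  have "\<exists>r>0. \<forall>u v. u \<le> t \<longrightarrow> t \<le> v \<longrightarrow> u \<in> ball t r \<longrightarrow> v \<in> ball t r \<longrightarrow> - e1 * (v - u) \<le> f v - f u"
    if "t \<notin> N" "t \<in> {a..b}" for t
    using good[OF that] straddle_lower_bound[of f _ t e1] \<open>e1 > 0\<close> by metis
  then obtain r where r: "\<And>t. t \<notin> N \<Longrightarrow> t \<in> {a..b} \<Longrightarrow> r t > 0 \<and>
      (\<forall>u v. u \<le> t \<longrightarrow> t \<le> v \<longrightarrow> u \<in> ball t (r t) \<longrightarrow> v \<in> ball t (r t) \<longrightarrow> - e1 * (v - u) \<le> f v - f u)"
    by metis
  define g where "g t = (if t \<in> N then U else if t \<in> {a..b} then ball t (r t) else UNIV)" for t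
  have "gauge g"
    using U r by (auto simp: gauge_def g_def)
  then obtain p where p: "p tagged_division_of {a..b}" "g fine p"
    using fine_division_exists_real by blast
  note pD = tagged_division_ofD[OF p(1)]
  have K: "K = {Inf K..Sup K}" "Inf K \<le> t" "t \<le> Sup K" "Inf K \<le> Sup K"
      "interior K = {Inf K<..<Sup K}" if "(t, K) \<in> p" for t K
  proof -
    from pD(4)[OF that] obtain c d where cd: "K = {c..d}" unfolding box_real by (elim exE)
    have "t \<in> K" using pD(2)[OF that] .
    then have t: "c \<le> t" "t \<le> d" using cd by simp_all
    then have *: "Inf K = c" "Sup K = d" using cd by simp_all
    show "K = {Inf K..Sup K}" "Inf K \<le> t" "t \<le> Sup K" "Inf K \<le> Sup K"
      "interior K = {Inf K<..<Sup K}"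
      unfolding * using cd t by simp_all
  qed
  define p1 where "p1 = {x \<in> p. fst x \<in> N}"
  define p2 where "p2 = {x \<in> p. fst x \<notin> N}"
  have fin: "finite p1" "finite p2" and pu: "p = p1 \<union> p2" "p1 \<inter> p2 = {}"
    using pD(1) by (auto simp: p1_def p2_def)
  have "f b - f a = (\<Sum>(t, K)\<in>p. f (Sup K) - f (Inf K))"
    using additive_tagged_division_1[OF \<open>a \<le> b\<close> p(1), of f] by simp
  also have "\<dots> = (\<Sum>(t, K)\<in>p1. f (Sup K) - f (Inf K)) + (\<Sum>(t, K)\<in>p2. f (Sup K) - f (Inf K))"
    using fin pu by (simp add: sum.union_disjoint)
  also have "\<dots> \<ge> - (e / 2) + - (e / 2)"
  proof (rule add_mono)
    define h where "h x = (Inf (snd x), Sup (snd x))" for x :: "real \<times> real set"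
    have inj: "inj_on h p1"
    proof (rule inj_onI, clarify)
      fix t K t' K' assume *: "(t, K) \<in> p1" "(t', K') \<in> p1" "h (t, K) = h (t', K')"
      then have in_p: "(t, K) \<in> p" "(t', K') \<in> p" by (auto simp: p1_def)
      have "K = K'" using *(3) K(1)[OF in_p(1)] K(1)[OF in_p(2)] by (simp add: h_def)
      moreover have "t = t'"
      proof (rule ccontr)
        assume "t \<noteq> t'"
        then have "interior K \<inter> interior K' = {}" using pD(5)[OF in_p] by auto
        then have "Inf K \<ge> Sup K"
          using K(5)[OF in_p(1)] \<open>K = K'\<close> dense by fastforce
        then show False using K(2,3)[OF in_p(1)] K(2,3)[OF in_p(2)] \<open>K = K'\<close> \<open>t \<noteq> t'\<close> by auto
      qed
      ultimately show "t = t' \<and> K = K'" by simp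
    qed
    have disj: "disjoint_family_on (\<lambda>(t, K). interior K) p1"
      using pD(5) by (fastforce simp: disjoint_family_on_def p1_def)
    have le: "(\<Sum>(u, v)\<in>h ` p1. v - u) \<le> measure lebesgue U"
    proof -
      have "(\<Sum>(u, v)\<in>h ` p1. v - u) = (\<Sum>(t, K)\<in>p1. Sup K - Inf K)"
        by (subst sum.reindex[OF inj]) (simp add: h_def case_prod_unfold o_def)
      also have "\<dots> = (\<Sum>x\<in>p1. measure lebesgue (case x of (t, K) \<Rightarrow> interior K))"
        by (intro sum.cong) (auto simp: p1_def K)
      also have "\<dots> = measure lebesgue (\<Union>x\<in>p1. case x of (t, K) \<Rightarrow> interior K)"
      proof (rule measure_UNION_AE[symmetric, OF fin(1)])
        show "(case x of (t, K) \<Rightarrow> interior K) \<in> lmeasurable" if "x \<in> p1" for x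
          using that K(5) by (cases x) (auto simp: p1_def)
      next
        show "pairwise (\<lambda>m n. AE x in lebesgue. x \<notin> (case m of (t, K) \<Rightarrow> interior K) \<or> x \<notin> (case n of (t, K) \<Rightarrow> interior K)) p1"
          using disj by (fastforce simp: pairwise_def disjoint_family_on_def intro!: AE_I2)
      qed
      also have "\<dots> \<le> measure lebesgue U"
      proof (rule measure_mono_fmeasurable[OF _ _ Ulm])
        show "(\<Union>x\<in>p1. case x of (t, K) \<Rightarrow> interior K) \<subseteq> U"
        proof clarify
          fix y t K assume "(t, K) \<in> p1" "y \<in> interior K"
          then have "(t, K) \<in> p" "t \<in> N" by (auto simp: p1_def)
          then have "K \<subseteq> U" using fineD[OF p(2), of t K] by (simp add: g_def)
          then show "y \<in> U" using \<open>y \<in> interior K\<close> interior_subset by blast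
        qed
        show "(\<Union>x\<in>p1. case x of (t, K) \<Rightarrow> interior K) \<in> sets lebesgue"
          by (intro sets_completionI_sets) (auto simp: case_prod_unfold intro!: borel_open)
      qed
      finally show ?thesis .
    qed
    have "(\<Sum>(u, v)\<in>h ` p1. norm (f v - f u)) < e / 2"
    proof (rule \<delta>, intro conjI)
      show "finite (h ` p1)" using fin by simp
      show "\<forall>(u, v)\<in>h ` p1. u \<le> v \<and> {u..v} \<subseteq> {a..b}"
      proof clarify
        fix u v t K assume "(u, v) = h (t, K)" "(t, K) \<in> p1"
        then have "u = Inf K" "v = Sup K" "(t, K) \<in> p" by (auto simp: h_def p1_def)
        then show "u \<le> v \<and> {u..v} \<subseteq> {a..b}"
          using K(1,4) pD(3) by metis
      qed
      show "disjoint_family_on (\<lambda>(u, v). {u<..<v}) (h ` p1)"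
        unfolding disjoint_family_on_def
      proof (intro ballI impI)
        fix m n assume "m \<in> h ` p1" "n \<in> h ` p1" "m \<noteq> n"
        obtain t K where 1: "(t, K) \<in> p1" "m = h (t, K)" using \<open>m \<in> h ` p1\<close> by (metis imageE surj_pair)
        obtain t' K' where 2: "(t', K') \<in> p1" "n = h (t', K')" using \<open>n \<in> h ` p1\<close> by (metis imageE surj_pair)
        have *: "(t, K) \<in> p" "(t', K') \<in> p" "(t, K) \<noteq> (t', K')"
            "m = (Inf K, Sup K)" "n = (Inf K', Sup K')"
          using 1 2 \<open>m \<noteq> n\<close> by (auto simp: h_def p1_def)
        then show "(case m of (u, v) \<Rightarrow> {u<..<v}) \<inter> (case n of (u, v) \<Rightarrow> {u<..<v}) = {}"
          using pD(5)[OF *(1-3)] K(5)[OF *(1)] K(5)[OF *(2)] by simp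
      qed
      show "(\<Sum>(u, v)\<in>h ` p1. v - u) < \<delta>" using le Umeas by simp
    qed
    then have "(\<Sum>(t, K)\<in>p1. norm (f (Sup K) - f (Inf K))) < e / 2"
      by (subst (asm) sum.reindex[OF inj]) (simp add: h_def case_prod_unfold o_def)
    moreover have "\<bar>\<Sum>(t, K)\<in>p1. f (Sup K) - f (Inf K)\<bar> \<le> (\<Sum>(t, K)\<in>p1. norm (f (Sup K) - f (Inf K)))"
      by (simp add: case_prod_unfold sum_abs)
    ultimately show "- (e / 2) \<le> (\<Sum>(t, K)\<in>p1. f (Sup K) - f (Inf K))" by linarith
  next
    have p2: "- e1 * (Sup K - Inf K) \<le> f (Sup K) - f (Inf K)" if "(t, K) \<in> p2" for t K
    proof -
      have *: "(t, K) \<in> p" "t \<notin> N" using that by (auto simp: p2_def)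
      have t: "t \<in> {a..b}" using pD(2,3)[OF *(1)] by auto
      have "K \<subseteq> ball t (r t)" using fineD[OF p(2) *(1)] *(2) t by (simp add: g_def)
      moreover have "Inf K \<in> K" "Sup K \<in> K" using K[OF *(1)] by (metis atLeastAtMost_iff order_refl)+
      ultimately show ?thesis using r[OF *(2) t] K(2,3)[OF *(1)] by blast
    qed
    have "- (e / 2) \<le> - e1 * (b - a)" using e1 by simp
    also have "b - a = (\<Sum>(t, K)\<in>p. Sup K - Inf K)"
      using additive_tagged_division_1[OF \<open>a \<le> b\<close> p(1), of "\<lambda>x. x"] by simp
    also have "- e1 * \<dots> \<le> - e1 * (\<Sum>(t, K)\<in>p2. Sup K - Inf K)"
    proof -
      have "(\<Sum>(t, K)\<in>p2. Sup K - Inf K) \<le> (\<Sum>(t, K)\<in>p. Sup K - Inf K)"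
        using K(4) pD(1) pu by (intro sum_mono2) fastforce+
      then show ?thesis using \<open>e1 > 0\<close> by simp
    qed
    also have "\<dots> = (\<Sum>(t, K)\<in>p2. - e1 * (Sup K - Inf K))"
      by (simp add: sum_distrib_left case_prod_unfold)
    finally show "- (e / 2) \<le> (\<Sum>(t, K)\<in>p2. f (Sup K) - f (Inf K))"
      using sum_mono[of p2 "\<lambda>(t, K). - e1 * (Sup K - Inf K)" "\<lambda>(t, K). f (Sup K) - f (Inf K)"] p2
      by (smt (verit) case_prod_conv surj_pair)
  qed
  finally show "f a \<le> f b + e" by simp
qed

lemma abs_continuous_on_dominated:
  fixes x :: "real \<Rightarrow> 'a::real_normed_vector" and h :: "real \<Rightarrow> 'b::real_normed_vector"
  assumes ac: "abs_continuous_on S x"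
    and le: "\<And>s t. s \<in> S \<Longrightarrow> t \<in> S \<Longrightarrow> s \<le> t \<Longrightarrow> norm (h t - h s) \<le> C * norm (x t - x s) + D * (t - s)"
    and "C \<ge> 0" "D \<ge> 0"
  shows "abs_continuous_on S h"
  unfolding abs_continuous_on_def
proof (intro allI impI)
  fix e :: real assume "e > 0"
  then have "e / 2 / (C + 1) > 0" using \<open>C \<ge> 0\<close> by simp
  then obtain \<delta> where "\<delta> > 0" and \<delta>: "\<And>I :: (real \<times> real) set.
        finite I \<and> (\<forall>(u, v)\<in>I. u \<le> v \<and> {u..v} \<subseteq> S) \<and>
        disjoint_family_on (\<lambda>(u, v). {u<..<v}) I \<and> (\<Sum>(u, v)\<in>I. v - u) < \<delta>
        \<Longrightarrow> (\<Sum>(u, v)\<in>I. norm (x v - x u)) < e / 2 / (C + 1)"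
    using ac unfolding abs_continuous_on_def by meson
  show "\<exists>\<delta>>0. \<forall>I. finite I \<and> (\<forall>(u, v)\<in>I. u \<le> v \<and> {u..v} \<subseteq> S) \<and>
        disjoint_family_on (\<lambda>(u, v). {u<..<v}) I \<and> (\<Sum>(u, v)\<in>I. v - u) < \<delta>
        \<longrightarrow> (\<Sum>(u, v)\<in>I. norm (h v - h u)) < e"
  proof (intro exI[of _ "min \<delta> (e / 2 / (D + 1))"] conjI allI impI)
    show "min \<delta> (e / 2 / (D + 1)) > 0" using \<open>\<delta> > 0\<close> \<open>e > 0\<close> \<open>D \<ge> 0\<close> by simp
    fix I assume I: "finite I \<and> (\<forall>(u, v)\<in>I. u \<le> v \<and> {u..v} \<subseteq> S) \<and>
        disjoint_family_on (\<lambda>(u, v). {u<..<v}) I \<and> (\<Sum>(u, v)\<in>I. v - u) < min \<delta> (e / 2 / (D + 1))"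
    have "(\<Sum>(u, v)\<in>I. norm (h v - h u)) \<le> (\<Sum>(u, v)\<in>I. C * norm (x v - x u) + D * (v - u))"
    proof (rule sum_mono, clarify)
      fix u v assume "(u, v) \<in> I"
      then have "u \<le> v" "{u..v} \<subseteq> S" using I by auto
      then show "norm (h v - h u) \<le> C * norm (x v - x u) + D * (v - u)" by (intro le) auto
    qed
    also have "\<dots> = C * (\<Sum>(u, v)\<in>I. norm (x v - x u)) + D * (\<Sum>(u, v)\<in>I. v - u)"
      by (simp add: sum.distrib sum_distrib_left case_prod_unfold)
    also have "\<dots> < e / 2 + e / 2"
    proof (rule add_le_less_mono)
      have "C * (\<Sum>(u, v)\<in>I. norm (x v - x u)) \<le> C * (e / 2 / (C + 1))"
        using \<delta>[of I] I \<open>C \<ge> 0\<close> by (intro mult_left_mono) auto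
      also have "\<dots> \<le> e / 2" using \<open>C \<ge> 0\<close> \<open>e > 0\<close> by (simp add: field_simps)
      finally show "C * (\<Sum>(u, v)\<in>I. norm (x v - x u)) \<le> e / 2" .
      have "D * (\<Sum>(u, v)\<in>I. v - u) \<le> D * (e / 2 / (D + 1))"
        using I \<open>D \<ge> 0\<close> by (intro mult_left_mono) auto
      also have "\<dots> < e / 2" using \<open>D \<ge> 0\<close> \<open>e > 0\<close> by (simp add: field_simps)
      finally show "D * (\<Sum>(u, v)\<in>I. v - u) < e / 2" .
    qed
    finally show "(\<Sum>(u, v)\<in>I. norm (h v - h u)) < e" by simp
  qed
qed

lemma abs_continuous_on_subset:
  assumes "abs_continuous_on S f" "R \<subseteq> S"
  shows "abs_continuous_on R f"
  unfolding abs_continuous_on_def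
proof (intro allI impI)
  fix e :: real assume "e > 0"
  then obtain \<delta> where "\<delta> > 0" and \<delta>: "\<And>I :: (real \<times> real) set.
        finite I \<and> (\<forall>(u, v)\<in>I. u \<le> v \<and> {u..v} \<subseteq> S) \<and>
        disjoint_family_on (\<lambda>(u, v). {u<..<v}) I \<and> (\<Sum>(u, v)\<in>I. v - u) < \<delta>
        \<Longrightarrow> (\<Sum>(u, v)\<in>I. norm (f v - f u)) < e"
    using assms(1) unfolding abs_continuous_on_def by meson
  show "\<exists>\<delta>>0. \<forall>I. finite I \<and> (\<forall>(u, v)\<in>I. u \<le> v \<and> {u..v} \<subseteq> R) \<and>
        disjoint_family_on (\<lambda>(u, v). {u<..<v}) I \<and> (\<Sum>(u, v)\<in>I. v - u) < \<delta>
        \<longrightarrow> (\<Sum>(u, v)\<in>I. norm (f v - f u)) < e"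
    using \<open>\<delta> > 0\<close> assms(2) by (intro exI[of _ \<delta>] conjI allI impI \<delta>) fast+
qed

lemma abs_continuous_on_imp_continuous_on:
  fixes x :: "real \<Rightarrow> 'a::real_normed_vector"
  assumes ac: "abs_continuous_on {a..b} x"
  shows "continuous_on {a..b} x"
  unfolding continuous_on_iff
proof (intro ballI allI impI)
  fix t and e :: real assume t: "t \<in> {a..b}" and "e > 0"
  then obtain \<delta> where "\<delta> > 0" and \<delta>: "\<And>I :: (real \<times> real) set.
        finite I \<and> (\<forall>(u, v)\<in>I. u \<le> v \<and> {u..v} \<subseteq> {a..b}) \<and>
        disjoint_family_on (\<lambda>(u, v). {u<..<v}) I \<and> (\<Sum>(u, v)\<in>I. v - u) < \<delta>
        \<Longrightarrow> (\<Sum>(u, v)\<in>I. norm (x v - x u)) < e"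
    using ac unfolding abs_continuous_on_def by meson
  have *: "norm (x v - x u) < e" if "u \<le> v" "v - u < \<delta>" "u \<in> {a..b}" "v \<in> {a..b}" for u v
    using \<delta>[of "{(u, v)}"] that by (simp add: disjoint_family_on_def)
  show "\<exists>d>0. \<forall>s\<in>{a..b}. dist s t < d \<longrightarrow> dist (x s) (x t) < e"
  proof (intro exI[of _ \<delta>] conjI ballI impI)
    fix s assume "s \<in> {a..b}" "dist s t < \<delta>"
    then show "dist (x s) (x t) < e"
      using *[of s t] *[of t s] t by (cases "s \<le> t") (auto simp: dist_norm norm_minus_commute)
  qed (use \<open>\<delta> > 0\<close> in auto)
qed

text \<open>One inequality of the fundamental theorem of calculus, under a one-sided bound on the derivative
  almost everywhere. No measurability of the derivative is needed.\<close>

lemma abs_continuous_on_integral_le: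
  fixes h :: "real \<Rightarrow> real"
  assumes ac: "abs_continuous_on {a..b} h" and ab: "a \<le> b"
    and g: "continuous_on UNIV g"
    and ae: "AE t in lebesgue. t \<in> {a..b} \<longrightarrow> (\<exists>d\<ge>g t. (h has_real_derivative d) (at t))"
  shows "integral {a..b} g \<le> h b - h a"
proof -
  \<comment> \<open>starting the primitive left of \<open>a\<close> makes it differentiable, two-sidedly, at \<open>a\<close>\<close>
  define G where "G t = integral {a - 1..t} g" for t
  have contg: "continuous_on S g" for S using g continuous_on_subset by blast
  have G: "(G has_real_derivative g t) (at t)" if "t \<in> {a..b}" for t
  proof -
    have "(G has_real_derivative g t) (at t within {a - 1..b + 1})"
      unfolding G_def using that by (intro integral_has_real_derivative contg) auto
    then show ?thesis using that by (simp add: at_within_Icc_at)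
  qed
  obtain D where D: "\<And>t. t \<in> {a..b} \<Longrightarrow> \<bar>g t\<bar> \<le> D"
    using compact_continuous_image[OF contg[of "{a..b}"] compact_Icc]
    by (metis (mono_tags, lifting) bounded_iff compact_imp_bounded imageI real_norm_def)
  have D0: "D \<ge> 0" using D[of a] ab by auto
  have "abs_continuous_on {a..b} (\<lambda>t. h t - G t)"
  proof (rule abs_continuous_on_dominated[OF ac, where C = 1 and D = D])
    fix s t assume st: "s \<in> {a..b}" "t \<in> {a..b}" "s \<le> t"
    have "norm (G t - G s) \<le> D * norm (t - s)"
    proof (rule field_differentiable_bound[of "{a..b}" G g])
      show "(G has_field_derivative g z) (at z within {a..b})" if "z \<in> {a..b}" for z
        using G[OF that] has_field_derivative_at_within by blast
    qed (use st D in auto)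
    then show "norm (h t - G t - (h s - G s)) \<le> 1 * norm (h t - h s) + D * (t - s)"
      using st by simp
  qed (use D0 in auto)
  then have "h a - G a \<le> h b - G b"
  proof (rule abs_continuous_on_nondecreasing[OF _ ab])
    show "AE t in lebesgue. t \<in> {a..b} \<longrightarrow> (\<exists>d\<ge>0. ((\<lambda>t. h t - G t) has_real_derivative d) (at t))"
      using ae
    proof (rule AE_mp, intro AE_I2 impI)
      fix t assume "t \<in> {a..b} \<longrightarrow> (\<exists>d\<ge>g t. (h has_real_derivative d) (at t))" "t \<in> {a..b}"
      then obtain d where "d \<ge> g t" "(h has_real_derivative d) (at t)" by blast
      then show "\<exists>d\<ge>0. ((\<lambda>t. h t - G t) has_real_derivative d) (at t)"
        using G[OF \<open>t \<in> {a..b}\<close>]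
        by (intro exI[of _ "d - g t"]) (auto intro: DERIV_diff)
    qed
  qed
  moreover have "G b - G a = integral {a..b} g"
    using Henstock_Kurzweil_Integration.integral_combine[of "a - 1" a b g] ab contg
    by (simp add: G_def integrable_continuous_interval)
  ultimately show ?thesis by simp
qed

lemma abs_continuous_on_inner:
  fixes x g :: "real \<Rightarrow> 'a::real_inner"
  assumes ac: "abs_continuous_on {a..b} x"
    and g: "\<And>t. t \<in> {a..b} \<Longrightarrow> (g has_vector_derivative g' t) (at t within {a..b})"
    and g': "continuous_on {a..b} g'"
  shows "abs_continuous_on {a..b} (\<lambda>t. x t \<bullet> g t)"
proof -
  have bnd: "\<exists>C\<ge>0. \<forall>t\<in>{a..b}. norm (f t) \<le> C" if f: "continuous_on {a..b} f" for f :: "real \<Rightarrow> 'a"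
  proof -
    obtain C where "\<forall>y\<in>f ` {a..b}. norm y \<le> C"
      using compact_imp_bounded[OF compact_continuous_image[OF f compact_Icc]] by (auto simp: bounded_iff)
    then show ?thesis by (intro exI[of _ "max C 0"]) (auto simp: le_max_iff_disj)
  qed
  obtain X where X: "X \<ge> 0" "\<And>t. t \<in> {a..b} \<Longrightarrow> norm (x t) \<le> X"
    using bnd[OF abs_continuous_on_imp_continuous_on[OF ac]] by blast
  obtain G where G: "G \<ge> 0" "\<And>t. t \<in> {a..b} \<Longrightarrow> norm (g t) \<le> G"
    using bnd[OF continuous_on_vector_derivative[OF g]] by blast
  obtain G' where G': "G' \<ge> 0" "\<And>t. t \<in> {a..b} \<Longrightarrow> norm (g' t) \<le> G'"
    using bnd[OF g'] by blast
  show ?thesis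
  proof (rule abs_continuous_on_dominated[OF ac, where C = G and D = "X * G'"])
    fix s t assume st: "s \<in> {a..b}" "t \<in> {a..b}" "s \<le> t"
    have lip: "norm (g t - g s) \<le> G' * norm (t - s)"
    proof (rule differentiable_bound[of "{a..b}" g "\<lambda>t h. h *\<^sub>R g' t"])
      show "(g has_derivative (\<lambda>h. h *\<^sub>R g' z)) (at z within {a..b})" if "z \<in> {a..b}" for z
        using g[OF that] by (simp add: has_vector_derivative_def)
      show "onorm (\<lambda>h. h *\<^sub>R g' z) \<le> G'" if "z \<in> {a..b}" for z
        using G'(2)[OF that] by (intro onorm_le) (simp add: mult.commute[of G'] mult_left_mono)
    qed (use st in auto)
    have "x t \<bullet> g t - x s \<bullet> g s = (x t - x s) \<bullet> g t + x s \<bullet> (g t - g s)"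
      by (simp add: inner_diff_left inner_diff_right)
    also have "\<bar>\<dots>\<bar> \<le> norm (x t - x s) * norm (g t) + norm (x s) * norm (g t - g s)"
      by (intro order_trans[OF abs_triangle_ineq] add_mono Cauchy_Schwarz_ineq2)
    also have "\<dots> \<le> norm (x t - x s) * G + X * (G' * norm (t - s))"
      using st G X lip by (intro add_mono mult_mono) auto
    finally show "norm (x t \<bullet> g t - x s \<bullet> g s) \<le> G * norm (x t - x s) + X * G' * (t - s)"
      using st by (simp add: mult_ac)
  qed (use G X G' in auto)
qed

section \<open>The torus mean\<close>

text \<open>The mean value over the torus of a function on \<open>\<real>\<^sup>N\<close> that is \<open>2\<pi>\<close>-periodic in each variable,
  computed on the fundamental cube. Periodicity is not part of the definition.\<close>

definition torus_mean :: "(real ^ 'n \<Rightarrow> real) \<Rightarrow> real" where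
  "torus_mean F = 1 / (2 * pi) ^ CARD('n) * (LINT \<phi>:cbox (0 :: real ^ 'n) (\<chi> i. 2 * pi)|lborel. F \<phi>)"

lemma continuous_on_set_integrable_cbox:
  fixes F :: "'a::euclidean_space \<Rightarrow> 'b::{banach, second_countable_topology}"
  assumes "continuous_on UNIV F"
  shows "set_integrable lborel (cbox a b) F"
  unfolding set_integrable_def
  by (rule borel_integrable_compact) (use assms continuous_on_subset in auto)

lemma torus_mean_add:
  assumes "continuous_on UNIV F" "continuous_on UNIV G"
  shows "torus_mean (\<lambda>\<phi>. F \<phi> + G \<phi>) = torus_mean F + torus_mean G"
  using assms by (simp add: torus_mean_def set_integral_add continuous_on_set_integrable_cbox algebra_simps)

lemma torus_mean_scale: "torus_mean (\<lambda>\<phi>. c * F \<phi>) = c * torus_mean F"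
  by (simp add: torus_mean_def)

lemma set_integral_cube_prod:
  fixes g :: "'n::finite \<Rightarrow> real \<Rightarrow> complex"
  assumes g: "\<And>i. continuous_on UNIV (g i)"
  shows "(LINT \<phi>:cbox (0 :: real ^ 'n) (\<chi> i. c)|lborel. (\<Prod>i\<in>UNIV. g i (\<phi> $ i))) = (\<Prod>i\<in>UNIV. LINT s:{0..c}|lborel. g i s)"
proof -
  interpret product_sigma_finite "\<lambda>_ :: real ^ 'n. lborel :: real measure" ..
  define idx where "idx b = (SOME i. b = axis i (1::real))" for b :: "real ^ 'n"
  have idx[simp]: "idx (axis i 1) = i" for i
    unfolding idx_def by (rule some_equality) (auto simp: axis_eq_axis)
  have inj: "inj (\<lambda>i :: 'n. axis i (1::real))" by (auto simp: inj_def axis_eq_axis)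
  have Basis: "(Basis :: (real ^ 'n) set) = range (\<lambda>i. axis i 1)" by (auto simp: Basis_vec_def)
  define h where "h i s = indicat_real {0..c} s *\<^sub>R g i s" for i s
  have hint: "integrable lborel (h i)" for i
    using continuous_on_set_integrable_cbox[OF g[of i], of 0 c] unfolding h_def[abs_def] set_integrable_def by simp
  have [measurable]: "h i \<in> borel_measurable borel" for i
    using borel_measurable_integrable[OF hint] by simp
  have ind: "indicat_real (cbox 0 (\<chi> i. c)) \<phi> *\<^sub>R (\<Prod>i\<in>UNIV. g i (\<phi> $ i)) = (\<Prod>i\<in>UNIV. h i (\<phi> $ i))" for \<phi> :: "real ^ 'n"
  proof (cases "\<phi> \<in> cbox 0 (\<chi> i. c)")
    case True
    then have "\<phi> $ i \<in> {0..c}" for i by (auto simp: mem_box_cart)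
    then show ?thesis using True by (simp add: h_def)
  next
    case False
    then obtain i where "\<phi> $ i \<notin> {0..c}" by (auto simp: mem_box_cart)
    then have "h i (\<phi> $ i) = 0" by (simp add: h_def)
    then show ?thesis using False by (auto intro!: prod_zero[symmetric])
  qed
  have comp: "(\<Sum>b\<in>Basis. f b *\<^sub>R b) $ i = f (axis i 1)" for f and i :: 'n
    proof -
    have "(\<Sum>b\<in>Basis. f b *\<^sub>R b) $ i = (\<Sum>j\<in>UNIV. f (axis j 1) * axis j 1 $ i)"
      by (simp add: Basis sum.reindex[OF inj])
    also have "\<dots> = (\<Sum>j\<in>UNIV. if j = i then f (axis i 1) else 0)"
      by (intro sum.cong) (auto simp: axis_def)
    finally show ?thesis by simp
  qed
  have "(LINT \<phi>:cbox (0 :: real ^ 'n) (\<chi> i. c)|lborel. (\<Prod>i\<in>UNIV. g i (\<phi> $ i))) = (LINT \<phi>|lborel. (\<Prod>i\<in>UNIV. h i (\<phi> $ i)))"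
    by (simp add: set_lebesgue_integral_def ind)
  also have "\<dots> = (\<integral>f. (\<Prod>i\<in>UNIV. h i ((\<Sum>b\<in>Basis. f b *\<^sub>R b :: real ^ 'n) $ i)) \<partial>(\<Pi>\<^sub>M b\<in>Basis. lborel))"
    by (subst lborel_eq, subst integral_distr) (auto intro!: borel_measurable_prod)
  also have "\<dots> = (\<integral>f. (\<Prod>b\<in>Basis. h (idx b) (f b)) \<partial>(\<Pi>\<^sub>M b\<in>Basis. lborel))"
    unfolding comp by (simp add: Basis prod.reindex[OF inj])
  also have "\<dots> = (\<Prod>b\<in>Basis. integral\<^sup>L lborel (h (idx b)))"
    by (rule product_integral_prod) (auto simp: hint)
  also have "\<dots> = (\<Prod>i\<in>UNIV. LINT s:{0..c}|lborel. g i s)"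
    unfolding set_lebesgue_integral_def by (simp add: Basis prod.reindex[OF inj] h_def[abs_def])
  finally show ?thesis .
qed

lemma integral_cis_period:
  fixes m :: int
  shows "(LINT s:{0..2 * pi}|lborel. cis (of_int m * s)) = (if m = 0 then of_real (2 * pi) else 0)"
proof -
  have "(LINT s:{0..2 * pi}|lborel. cis (of_int m * s)) = integral {0..2 * pi} (\<lambda>s. cis (of_int m * s))"
  proof (rule set_borel_integral_eq_integral)
    have "continuous_on UNIV (\<lambda>s. cis (of_int m * s))" by (intro continuous_intros)
    from continuous_on_set_integrable_cbox[OF this, of 0 "2 * pi"]
    show "set_integrable lborel {0..2 * pi} (\<lambda>s. cis (of_int m * s))" by simp
  qed
  also have "\<dots> = (if m = 0 then of_real (2 * pi) else 0)"
  proof (cases "m = 0")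
    case False
    have "((\<lambda>s. cis (of_int m * s)) has_integral
        cis (of_int m * (2 * pi)) / (\<i> * of_int m) - cis (of_int m * 0) / (\<i> * of_int m)) {0..2 * pi}"
    proof (rule fundamental_theorem_of_calculus)
      fix s :: real
      have "((\<lambda>s. cis (of_int m * s) / (\<i> * of_int m)) has_vector_derivative
          (of_int m *\<^sub>R (\<i> * cis (of_int m * s))) / (\<i> * of_int m)) (at s within {0..2 * pi})"
        unfolding has_vector_derivative_def
        by (auto intro!: derivative_eq_intros simp: scaleR_conv_of_real field_simps)
      then show "((\<lambda>s. cis (of_int m * s) / (\<i> * of_int m)) has_vector_derivative cis (of_int m * s)) (at s within {0..2 * pi})"
        using False by (simp add: scaleR_conv_of_real)
    qed simp
    moreover have "cis (of_int m * (2 * pi)) = 1"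
      by (metis cis_multiple_2pi mult.commute Ints_of_int)
    ultimately show ?thesis using False by (simp add: integral_unique)
  qed (simp add: scaleR_conv_of_real)
  finally show ?thesis .
qed

lemma torus_mean_cos:
  fixes m :: "int ^ 'n::finite"
  shows "torus_mean (\<lambda>\<phi>. cos ((\<Sum>i\<in>UNIV. of_int (m $ i) * \<phi> $ i) + \<beta>)) = (if m = 0 then cos \<beta> else 0)"
proof -
  let ?C = "cbox (0 :: real ^ 'n) (\<chi> i. 2 * pi)"
  have cis: "cis ((\<Sum>i\<in>UNIV. of_int (m $ i) * \<phi> $ i) + \<beta>) = cis \<beta> * (\<Prod>i\<in>UNIV. cis (of_int (m $ i) * \<phi> $ i))" for \<phi> :: "real ^ 'n"
  proof -
    have "cis (\<Sum>i\<in>A. of_int (m $ i) * \<phi> $ i) = (\<Prod>i\<in>A. cis (of_int (m $ i) * \<phi> $ i))" if "finite A" for A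
      using that by (induction A) (auto simp: cis_mult[symmetric])
    then show ?thesis by (simp add: cis_mult[symmetric] mult.commute)
  qed
  have "complex_of_real (\<Prod>i::'n\<in>UNIV. if m $ i = 0 then 2 * pi else 0)
      = (\<Prod>i\<in>UNIV. LINT s:{0..2 * pi}|lborel. cis (of_int (m $ i) * s))"
    unfolding integral_cis_period of_real_prod by (intro prod.cong) auto
  also have "\<dots> = (LINT \<phi>:?C|lborel. (\<Prod>i\<in>UNIV. cis (of_int (m $ i) * \<phi> $ i)))"
    by (rule set_integral_cube_prod[symmetric]) (auto intro!: continuous_intros)
  finally have P: "(LINT \<phi>:?C|lborel. (\<Prod>i\<in>UNIV. cis (of_int (m $ i) * \<phi> $ i)))
      = of_real (\<Prod>i::'n\<in>UNIV. if m $ i = 0 then 2 * pi else 0)" ..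
  have "(LINT \<phi>:?C|lborel. cos ((\<Sum>i\<in>UNIV. of_int (m $ i) * \<phi> $ i) + \<beta>))
     = Re (LINT \<phi>:?C|lborel. cis ((\<Sum>i\<in>UNIV. of_int (m $ i) * \<phi> $ i) + \<beta>))"
  proof -
    have "set_integrable lborel ?C (\<lambda>\<phi>. cis ((\<Sum>i\<in>UNIV. of_int (m $ i) * \<phi> $ i) + \<beta>))"
      by (rule continuous_on_set_integrable_cbox) (auto intro!: continuous_intros)
    then show ?thesis
      unfolding set_lebesgue_integral_def set_integrable_def
      by (subst integral_Re[symmetric]) auto
  qed
  also have "\<dots> = cos \<beta> * (\<Prod>i::'n\<in>UNIV. if m $ i = 0 then 2 * pi else 0)"
    unfolding cis by (simp add: P del: of_real_prod)
  finally have *: "torus_mean (\<lambda>\<phi>. cos ((\<Sum>i\<in>UNIV. of_int (m $ i) * \<phi> $ i) + \<beta>))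
      = 1 / (2 * pi) ^ CARD('n) * (cos \<beta> * (\<Prod>i::'n\<in>UNIV. if m $ i = 0 then 2 * pi else 0))"
    by (simp add: torus_mean_def)
  show ?thesis
  proof (cases "m = 0")
    case False
    then obtain i where "m $ i \<noteq> 0" by (auto simp: vec_eq_iff)
    then have "(\<Prod>i::'n\<in>UNIV. if m $ i = 0 then 2 * pi else 0) = 0"
      by (intro prod_zero) auto
    then show ?thesis using * False by simp
  qed (use * in simp)
qed

lemma torus_mean_const: "torus_mean (\<lambda>_ :: real ^ 'n::finite. c) = c"
  using torus_mean_scale[of c "\<lambda>_ :: real ^ 'n. 1"] torus_mean_cos[of "0 :: int ^ 'n" 0] by simp

lemma torus_mean_mono:
  fixes F G :: "real ^ 'n::finite \<Rightarrow> real"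
  assumes "continuous_on UNIV F" "continuous_on UNIV G" "\<And>\<phi>. F \<phi> \<le> G \<phi>"
  shows "torus_mean F \<le> torus_mean G"
  unfolding torus_mean_def
  using assms by (intro mult_left_mono set_integral_mono continuous_on_set_integrable_cbox) auto

lemma torus_mean_abs_diff_le:
  fixes F G :: "real ^ 'n::finite \<Rightarrow> real"
  assumes F: "continuous_on UNIV F" and G: "continuous_on UNIV G" and le: "\<And>\<phi>. \<bar>F \<phi> - G \<phi>\<bar> \<le> e"
  shows "\<bar>torus_mean F - torus_mean G\<bar> \<le> e"
proof -
  have "torus_mean F \<le> torus_mean (\<lambda>\<phi>. G \<phi> + e)" "torus_mean G \<le> torus_mean (\<lambda>\<phi>. F \<phi> + e)"
    using le by (intro torus_mean_mono continuous_intros F G; smt (verit))+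
  then show ?thesis
    using F G by (simp add: torus_mean_add torus_mean_const)
qed

section \<open>Equidistribution of linear flows on the torus\<close>

text \<open>Real trigonometric polynomials on the torus: the linear span of the functions
  \<open>cos (m \<bullet> \<phi> + \<beta>)\<close> with integral frequency vectors \<open>m\<close>. Arbitrary phases \<open>\<beta>\<close> cover the sines.\<close>

inductive_set trig_poly :: "(real ^ 'n::finite \<Rightarrow> real) set" where
  trig_poly_cos: "(\<lambda>\<phi>. cos ((\<Sum>i\<in>UNIV. of_int ((m :: int ^ 'n) $ i) * \<phi> $ i) + \<beta>)) \<in> trig_poly"
| trig_poly_add: "F \<in> trig_poly \<Longrightarrow> G \<in> trig_poly \<Longrightarrow> (\<lambda>\<phi>. F \<phi> + G \<phi>) \<in> trig_poly"
| trig_poly_scale: "F \<in> trig_poly \<Longrightarrow> (\<lambda>\<phi>. c * F \<phi>) \<in> trig_poly"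

lemma trig_poly_const: "(\<lambda>_. c) \<in> trig_poly"
  using trig_poly_scale[OF trig_poly_cos[of 0 0], of c] by simp

lemma trig_poly_sum:
  assumes "finite A" "\<And>i. i \<in> A \<Longrightarrow> F i \<in> trig_poly"
  shows "(\<lambda>\<phi>. \<Sum>i\<in>A. F i \<phi>) \<in> trig_poly"
  using assms by (induction A) (auto intro: trig_poly_add trig_poly_const)

lemma trig_poly_cos_mult:
  assumes "G \<in> trig_poly"
  shows "(\<lambda>\<phi>. cos ((\<Sum>i\<in>UNIV. of_int ((m :: int ^ 'n::finite) $ i) * \<phi> $ i) + \<beta>) * G \<phi>) \<in> trig_poly"
  using assms
proof induction
  case (trig_poly_cos m' \<beta>')
  let ?L = "\<lambda>m (\<phi> :: real ^ 'n). \<Sum>i\<in>UNIV. of_int ((m :: int ^ 'n) $ i) * \<phi> $ i"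
  have "cos (?L m \<phi> + \<beta>) * cos (?L m' \<phi> + \<beta>')
      = 1 / 2 * cos (?L (m - m') \<phi> + (\<beta> - \<beta>')) + 1 / 2 * cos (?L (m + m') \<phi> + (\<beta> + \<beta>'))" for \<phi>
    unfolding cos_times_cos
    by (simp add: algebra_simps sum.distrib sum_subtractf add_divide_distrib)
  then show ?case
    by (simp only:) (intro trig_poly.intros)
next
  case (trig_poly_add F G)
  then show ?case using trig_poly.trig_poly_add by (fastforce simp: distrib_left)
next
  case (trig_poly_scale F c)
  then show ?case using trig_poly.trig_poly_scale by (fastforce simp: mult.left_commute)
qed

lemma trig_poly_mult:
  assumes "F \<in> trig_poly" "G \<in> trig_poly"
  shows "(\<lambda>\<phi>. F \<phi> * G \<phi>) \<in> trig_poly"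
  using assms(1)
proof induction
  case (trig_poly_cos m \<beta>)
  then show ?case by (rule trig_poly_cos_mult[OF assms(2)])
next
  case (trig_poly_add F H)
  then show ?case using trig_poly.trig_poly_add by (fastforce simp: distrib_right)
next
  case (trig_poly_scale F c)
  then show ?case using trig_poly.trig_poly_scale by (fastforce simp: mult.assoc)
qed

lemma trig_poly_continuous: "F \<in> trig_poly \<Longrightarrow> continuous_on S F"
  by (induction rule: trig_poly.induct) (auto intro!: continuous_intros)

lemma trig_poly_bounded:
  assumes "F \<in> trig_poly" shows "\<exists>C. \<forall>\<phi>. \<bar>F \<phi>\<bar> \<le> C"
  using assms
proof induction
  case (trig_poly_cos m \<beta>)
  then show ?case by (intro exI[of _ 1]) simp
next
  case (trig_poly_add F G)
  then obtain C D where "\<And>\<phi>. \<bar>F \<phi>\<bar> \<le> C" "\<And>\<phi>. \<bar>G \<phi>\<bar> \<le> D" by blast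
  then have "\<bar>F \<phi> + G \<phi>\<bar> \<le> C + D" for \<phi>
    by (intro order_trans[OF abs_triangle_ineq] add_mono)
  then show ?case by blast
next
  case (trig_poly_scale F c)
  then obtain C where "\<And>\<phi>. \<bar>F \<phi>\<bar> \<le> C" by blast
  then have "\<bar>c * F \<phi>\<bar> \<le> \<bar>c\<bar> * C" for \<phi> by (simp add: abs_mult mult_left_mono)
  then show ?case by blast
qed

lemma trig_poly_shift:
  assumes "F \<in> trig_poly"
  shows "(\<lambda>\<phi>. F (\<phi> + \<alpha>)) \<in> trig_poly \<and> torus_mean (\<lambda>\<phi>. F (\<phi> + \<alpha>)) = torus_mean F"
  using assms
proof induction
  case (trig_poly_cos m \<beta>)
  have *: "cos ((\<Sum>i\<in>UNIV. of_int (m $ i) * (\<phi> + \<alpha>) $ i) + \<beta>)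
     = cos ((\<Sum>i\<in>UNIV. of_int (m $ i) * \<phi> $ i) + ((\<Sum>i\<in>UNIV. of_int (m $ i) * \<alpha> $ i) + \<beta>))" for \<phi>
    by (simp add: algebra_simps sum.distrib)
  show ?case
    unfolding * using torus_mean_cos[of m] by (auto intro: trig_poly.trig_poly_cos trig_poly_const)
next
  case (trig_poly_add F G)
  then show ?case
    by (auto intro: trig_poly.trig_poly_add simp: torus_mean_add trig_poly_continuous)
next
  case (trig_poly_scale F c)
  then show ?case by (auto intro: trig_poly.trig_poly_scale simp: torus_mean_scale)
qed

lemma integral_cos_linear:
  fixes k :: real assumes "k \<noteq> 0" "T \<ge> 0"
  shows "integral {0..T} (\<lambda>s. cos (k * s + \<beta>)) = (sin (k * T + \<beta>) - sin \<beta>) / k"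
proof -
  have "((\<lambda>s. cos (k * s + \<beta>)) has_integral sin (k * T + \<beta>) / k - sin (k * 0 + \<beta>) / k) {0..T}"
    using assms by (intro fundamental_theorem_of_calculus)
      (auto intro!: derivative_eq_intros simp: has_real_derivative_iff_has_vector_derivative[symmetric])
  then show ?thesis by (simp add: integral_unique diff_divide_distrib)
qed

text \<open>For \<open>m \<noteq> 0\<close> the function \<open>cos (m \<bullet> \<phi> + \<beta>)\<close> becomes \<open>cos (k s + \<beta>)\<close> with \<open>k = m \<bullet> \<omega> \<noteq> 0\<close> along the
  line \<open>s \<omega>\<close>, so its integral over \<open>[0, T]\<close> stays bounded.\<close>

lemma trig_poly_time_average:
  fixes \<omega> :: "real ^ 'n::finite"
  assumes "nonresonant \<omega>" and "F \<in> trig_poly"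
  shows "((\<lambda>T. 1 / T * integral {0..T} (\<lambda>s. F (s *\<^sub>R \<omega>))) \<longlongrightarrow> torus_mean F) at_top"
  using assms(2)
proof induction
  case (trig_poly_cos m \<beta>)
  define k where "k = (\<Sum>i\<in>UNIV. of_int (m $ i) * \<omega> $ i)"
  have *: "(\<Sum>i\<in>UNIV. of_int (m $ i) * (s *\<^sub>R \<omega>) $ i) = k * s" for s
    by (simp add: k_def sum_distrib_left algebra_simps)
  show ?case
  proof (cases "m = 0")
    case True
    then have "k = 0" by (simp add: k_def)
    have "\<forall>\<^sub>F T in at_top. 1 / T * integral {0..T} (\<lambda>s. cos (k * s + \<beta>)) = cos \<beta>"
      using eventually_gt_at_top[of 0] by eventually_elim (simp add: \<open>k = 0\<close>)
    then show ?thesis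
      unfolding * torus_mean_cos using True by (simp add: tendsto_eventually)
  next
    case False
    then have "k \<noteq> 0" using \<open>nonresonant \<omega>\<close> by (auto simp: nonresonant_def k_def)
    have "((\<lambda>T. 1 / T * integral {0..T} (\<lambda>s. cos (k * s + \<beta>))) \<longlongrightarrow> 0) at_top"
    proof (rule Lim_null_comparison)
      show "\<forall>\<^sub>F T in at_top. norm (1 / T * integral {0..T} (\<lambda>s. cos (k * s + \<beta>))) \<le> 2 / \<bar>k\<bar> * inverse T"
        using eventually_gt_at_top[of 0]
      proof eventually_elim
        case (elim T)
        have "\<bar>sin (k * T + \<beta>) - sin \<beta>\<bar> \<le> 2"
          using abs_sin_le_one[of "k * T + \<beta>"] abs_sin_le_one[of \<beta>] by linarith
        then show ?case using elim \<open>k \<noteq> 0\<close>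
          by (simp add: integral_cos_linear abs_mult divide_simps)
      qed
      show "((\<lambda>T. 2 / \<bar>k\<bar> * inverse T) \<longlongrightarrow> 0) at_top"
        by (intro tendsto_mult_right_zero tendsto_inverse_0_at_top filterlim_ident)
    qed
    then show ?thesis unfolding * torus_mean_cos using False by simp
  qed
next
  case (trig_poly_add F G)
  have "(\<lambda>s. H (s *\<^sub>R \<omega>)) integrable_on {0..T}" if "H \<in> trig_poly" for H T
    by (rule integrable_continuous_interval)
      (auto intro!: continuous_on_compose2[OF trig_poly_continuous[OF that, of UNIV]] continuous_intros)
  then show ?case
    using trig_poly_add tendsto_add[OF trig_poly_add.IH]
    by (simp add: torus_mean_add trig_poly_continuous Henstock_Kurzweil_Integration.integral_add distrib_left)
next
  case (trig_poly_scale F c)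
  then show ?case using tendsto_mult_left[OF trig_poly_scale.IH, of c]
    by (simp add: torus_mean_scale mult.left_commute)
qed

lemma trig_poly_approx_shift_mean:
  fixes F :: "real ^ 'n::finite \<Rightarrow> real"
  assumes F: "continuous_on UNIV F"
    and approx: "\<And>e. e > 0 \<Longrightarrow> \<exists>G\<in>trig_poly. \<forall>\<phi>. \<bar>F \<phi> - G \<phi>\<bar> \<le> e"
  shows "torus_mean (\<lambda>\<phi>. F (\<phi> + \<alpha>)) = torus_mean F"
proof -
  have "\<bar>torus_mean (\<lambda>\<phi>. F (\<phi> + \<alpha>)) - torus_mean F\<bar> \<le> 0 + e" if e: "e > 0" for e
  proof -
    obtain G where G: "G \<in> trig_poly" "\<And>\<phi>. \<bar>F \<phi> - G \<phi>\<bar> \<le> e / 2"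
      using approx[OF half_gt_zero[OF e]] by blast
    note G' = trig_poly_shift[OF G(1), of \<alpha>]
    have "\<bar>torus_mean F - torus_mean G\<bar> \<le> e / 2"
      by (rule torus_mean_abs_diff_le) (use F G trig_poly_continuous in auto)
    moreover have "\<bar>torus_mean (\<lambda>\<phi>. F (\<phi> + \<alpha>)) - torus_mean (\<lambda>\<phi>. G (\<phi> + \<alpha>))\<bar> \<le> e / 2"
      by (rule torus_mean_abs_diff_le)
        (use G G' trig_poly_continuous in \<open>auto intro!: continuous_on_compose2[OF F] continuous_intros\<close>)
    ultimately show ?thesis using G' by (simp add: abs_if split: if_splits)
  qed
  then have "\<bar>torus_mean (\<lambda>\<phi>. F (\<phi> + \<alpha>)) - torus_mean F\<bar> \<le> 0" by (rule field_le_epsilon)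
  then show ?thesis by simp
qed

lemma trig_poly_approx_time_average:
  fixes F :: "real ^ 'n::finite \<Rightarrow> real"
  assumes nonres: "nonresonant \<omega>" and F: "continuous_on UNIV F"
    and approx: "\<And>e. e > 0 \<Longrightarrow> \<exists>G\<in>trig_poly. \<forall>\<phi>. \<bar>F \<phi> - G \<phi>\<bar> \<le> e"
  shows "((\<lambda>T. 1 / T * integral {0..T} (\<lambda>s. F (s *\<^sub>R \<omega>))) \<longlongrightarrow> torus_mean F) at_top"
proof (rule tendstoI)
  fix e :: real assume "e > 0"
  then obtain G where G: "G \<in> trig_poly" "\<And>\<phi>. \<bar>F \<phi> - G \<phi>\<bar> \<le> e / 3"
    using approx[of "e / 3"] by auto
  have mean: "\<bar>torus_mean F - torus_mean G\<bar> \<le> e / 3"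
    by (rule torus_mean_abs_diff_le) (use F G trig_poly_continuous in auto)
  have "\<forall>\<^sub>F T in at_top. dist (1 / T * integral {0..T} (\<lambda>s. G (s *\<^sub>R \<omega>))) (torus_mean G) < e / 3"
    using trig_poly_time_average[OF nonres G(1)] \<open>e > 0\<close> by (intro tendstoD) auto
  then show "\<forall>\<^sub>F T in at_top. dist (1 / T * integral {0..T} (\<lambda>s. F (s *\<^sub>R \<omega>))) (torus_mean F) < e"
    using eventually_gt_at_top[of 0]
  proof eventually_elim
    case (elim T)
    have int: "(\<lambda>s. F (s *\<^sub>R \<omega>)) integrable_on {0..T}" "(\<lambda>s. G (s *\<^sub>R \<omega>)) integrable_on {0..T}"
      by (rule integrable_continuous_interval,
          auto intro!: continuous_on_compose2[OF F] continuous_on_compose2[OF trig_poly_continuous[OF G(1), of UNIV]]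
            continuous_intros)+
    have "norm (integral {0..T} (\<lambda>s. F (s *\<^sub>R \<omega>) - G (s *\<^sub>R \<omega>))) \<le> integral {0..T} (\<lambda>s. e / 3)"
      using int G(2) by (intro integral_norm_bound_integral integrable_diff) auto
    then have "\<bar>integral {0..T} (\<lambda>s. F (s *\<^sub>R \<omega>)) - integral {0..T} (\<lambda>s. G (s *\<^sub>R \<omega>))\<bar> \<le> T * (e / 3)"
      using int elim by (simp add: Henstock_Kurzweil_Integration.integral_diff)
    then have "\<bar>1 / T * integral {0..T} (\<lambda>s. F (s *\<^sub>R \<omega>)) - 1 / T * integral {0..T} (\<lambda>s. G (s *\<^sub>R \<omega>))\<bar> \<le> e / 3"
      using elim by (simp add: diff_divide_distrib[symmetric] abs_mult divide_simps mult.commute)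
    then show ?case using mean elim(1) unfolding dist_real_def by linarith
  qed
qed

text \<open>By the Weierstrass theorem in one variable, \<open>\<bar>F\<bar>\<close> is a uniform limit of polynomials in \<open>F\<close>.\<close>

lemma abs_trig_poly_approx:
  assumes F: "F \<in> trig_poly" and "e > 0"
  shows "\<exists>G\<in>trig_poly. \<forall>\<phi>. \<bar>\<bar>F \<phi>\<bar> - G \<phi>\<bar> \<le> e"
proof -
  obtain C where C: "\<And>\<phi>. \<bar>F \<phi>\<bar> \<le> C" using trig_poly_bounded[OF F] by blast
  have cont: "continuous_on {- C..C} (\<lambda>s :: real. \<bar>s\<bar>)" by (intro continuous_intros)
  obtain g :: "real \<Rightarrow> real" where g: "real_polynomial_function g" "\<And>s. s \<in> {- C..C} \<Longrightarrow> \<bar>\<bar>s\<bar> - g s\<bar> < e"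
    using Stone_Weierstrass_real_polynomial_function[OF compact_Icc cont \<open>e > 0\<close>] by blast
  have "(\<lambda>\<phi>. g (F \<phi>)) \<in> trig_poly"
    using g(1)
  proof induction
    case (linear f)
    then obtain c where "f = (\<lambda>s. s * c)" unfolding real_bounded_linear by (elim exE)
    then show ?case using trig_poly_scale[OF F, of c] by (simp add: mult.commute)
  next
    case (const c)
    show ?case by (rule trig_poly_const)
  next
    case (add f g)
    from trig_poly_add[OF add.IH] show ?case .
  next
    case (mult f g)
    from trig_poly_mult[OF mult.IH] show ?case .
  qed
  moreover have "\<bar>\<bar>F \<phi>\<bar> - g (F \<phi>)\<bar> \<le> e" for \<phi>
    using g(2)[of "F \<phi>"] C[of \<phi>] by (simp add: abs_le_iff less_imp_le)
  ultimately show ?thesis by (intro bexI[of _ "\<lambda>\<phi>. g (F \<phi>)"]) auto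
qed

lemma abs_trig_poly_continuous: "F \<in> trig_poly \<Longrightarrow> continuous_on S (\<lambda>\<phi>. \<bar>F \<phi>\<bar>)"
  by (intro continuous_intros trig_poly_continuous)

lemma torus_mean_abs_shift:
  assumes "F \<in> trig_poly"
  shows "torus_mean (\<lambda>\<phi>. \<bar>F (\<phi> + \<alpha>)\<bar>) = torus_mean (\<lambda>\<phi>. \<bar>F \<phi>\<bar>)"
  by (rule trig_poly_approx_shift_mean[of "\<lambda>\<phi>. \<bar>F \<phi>\<bar>"])
    (use assms abs_trig_poly_continuous abs_trig_poly_approx in auto)

lemma abs_time_average:
  assumes "nonresonant \<omega>" "F \<in> trig_poly"
  shows "((\<lambda>T. 1 / T * integral {0..T} (\<lambda>s. \<bar>F (s *\<^sub>R \<omega>)\<bar>)) \<longlongrightarrow> torus_mean (\<lambda>\<phi>. \<bar>F \<phi>\<bar>)) at_top"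
  by (rule trig_poly_approx_time_average[of _ "\<lambda>\<phi>. \<bar>F \<phi>\<bar>"])
    (use assms abs_trig_poly_continuous abs_trig_poly_approx in auto)

lemma torus_mean_eq_0_imp:
  fixes F :: "real ^ 'n::finite \<Rightarrow> real"
  assumes F: "continuous_on UNIV F" and "\<And>\<phi>. F \<phi> \<ge> 0" and "torus_mean F = 0"
    and "\<phi> \<in> cbox 0 (\<chi> i. 2 * pi)"
  shows "F \<phi> = 0"
proof (rule has_integral_0_cbox_imp_0[of 0 "\<chi> i. 2 * pi" F])
  have "(LINT \<phi>:cbox (0 :: real ^ 'n) (\<chi> i. 2 * pi)|lborel. F \<phi>) = 0"
    using assms(3) by (simp add: torus_mean_def)
  then have "integral (cbox 0 (\<chi> i. 2 * pi)) F = 0"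
    using set_borel_integral_eq_integral[OF continuous_on_set_integrable_cbox[OF F]] by metis
  moreover have "F integrable_on cbox 0 (\<chi> i. 2 * pi)"
    by (rule integrable_continuous[OF continuous_on_subset[OF F]]) auto
  ultimately show "(F has_integral 0) (cbox 0 (\<chi> i. 2 * pi))"
    by (metis integrable_integral)
  show "box (0 :: real ^ 'n) (\<chi> i. 2 * pi) \<noteq> {}"
    by (simp add: interval_ne_empty_cart)
qed (use assms continuous_on_subset[OF F] in auto)

section \<open>The norm H and its strict convexity\<close>

text \<open>The integrand of \<open>H\<close> before taking absolute values, written without polar coordinates and therefore
  linear in \<open>p\<close>. It agrees with \<open>\<Sum>\<^sub>i z\<^sub>i cos \<phi>\<^sub>i\<close> up to a translation of the torus.\<close>

definition torus_form :: "real ^ 'n \<Rightarrow> 'n::finite phase \<Rightarrow> real ^ 'n \<Rightarrow> real" where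
  "torus_form \<omega> p \<phi> = (\<Sum>i\<in>UNIV. snd (p $ i) * cos (\<phi> $ i) + fst (p $ i) / \<omega> $ i * sin (\<phi> $ i))"

lemma torus_form_add: "torus_form \<omega> (p + q) \<phi> = torus_form \<omega> p \<phi> + torus_form \<omega> q \<phi>"
  by (simp add: torus_form_def sum.distrib[symmetric] algebra_simps add_divide_distrib)

lemma torus_form_scaleR: "torus_form \<omega> (c *\<^sub>R p) \<phi> = c * torus_form \<omega> p \<phi>"
  by (simp add: torus_form_def sum_distrib_left algebra_simps)

lemma torus_form_diff: "torus_form \<omega> (p - q) \<phi> = torus_form \<omega> p \<phi> - torus_form \<omega> q \<phi>"
  using torus_form_add[of \<omega> "p - q" q \<phi>] by simp

lemma trig_poly_cos_component: "(\<lambda>\<phi>. cos (\<phi> $ i + \<beta>)) \<in> trig_poly"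
proof -
  have "(\<Sum>j\<in>UNIV. of_int (axis i 1 $ j) * \<phi> $ j) = \<phi> $ i" for \<phi> :: "real ^ 'a"
    by (simp add: axis_def if_distrib[of "\<lambda>x. of_int x * _"] cong: if_cong)
  then show ?thesis using trig_poly_cos[of "axis i 1" \<beta>] by simp
qed

lemma torus_form_trig_poly: "torus_form \<omega> p \<in> trig_poly"
proof -
  have "(\<lambda>\<phi>. \<Sum>i\<in>UNIV. snd (p $ i) * cos (\<phi> $ i + 0) + fst (p $ i) / \<omega> $ i * cos (\<phi> $ i + (- pi / 2))) \<in> trig_poly"
    by (intro trig_poly_sum finite_class.finite_UNIV trig_poly_add trig_poly_scale trig_poly_cos_component)
  moreover have "cos (s + (- pi / 2)) = sin s" for s :: real
    using cos_diff[of s "pi / 2"] by simp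
  ultimately show ?thesis unfolding torus_form_def[abs_def] by simp
qed

lemma continuous_on_torus_form: "continuous_on S (torus_form \<omega> p)"
  by (rule trig_poly_continuous[OF torus_form_trig_poly])

lemma torus_H_eq: "torus_H \<omega> p = torus_mean (\<lambda>\<phi>. \<bar>torus_form \<omega> p \<phi>\<bar>)"
proof -
  \<comment> \<open>the phases of the oscillating terms written as \<open>z\<^sub>i cos (\<phi>\<^sub>i + \<alpha>\<^sub>i)\<close>\<close>
  define \<alpha> :: "real ^ 'a" where "\<alpha> = (\<chi> i. Arg (Complex (snd (p $ i)) (- fst (p $ i) / \<omega> $ i)))"
  define F where "F \<phi> = (\<Sum>i\<in>UNIV. amplitude \<omega> p i * cos (\<phi> $ i))" for \<phi> :: "real ^ 'a"
  have F: "F \<in> trig_poly"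
    unfolding F_def[abs_def]
    using trig_poly_cos_component[of _ 0]
    by (intro trig_poly_sum finite_class.finite_UNIV trig_poly_scale) simp
  have "F (\<phi> + \<alpha>) = torus_form \<omega> p \<phi>" for \<phi>
    unfolding F_def torus_form_def
  proof (rule sum.cong[OF refl])
    fix i
    define z where "z = Complex (snd (p $ i)) (- fst (p $ i) / \<omega> $ i)"
    have amp: "amplitude \<omega> p i = cmod z"
      by (simp add: amplitude_def z_def cmod_def power_divide)
    have "rcis (cmod z) (\<alpha> $ i) = z" by (simp add: \<alpha>_def z_def rcis_cmod_Arg)
    then have "cmod z * cos (\<alpha> $ i) = Re z" "cmod z * sin (\<alpha> $ i) = Im z"
      by (metis Re_rcis, metis Im_rcis)
    moreover have "amplitude \<omega> p i * cos ((\<phi> + \<alpha>) $ i) =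
        (cmod z * cos (\<alpha> $ i)) * cos (\<phi> $ i) - (cmod z * sin (\<alpha> $ i)) * sin (\<phi> $ i)"
      by (simp add: amp cos_add algebra_simps)
    ultimately show "amplitude \<omega> p i * cos ((\<phi> + \<alpha>) $ i) =
        snd (p $ i) * cos (\<phi> $ i) + fst (p $ i) / \<omega> $ i * sin (\<phi> $ i)"
      by (simp add: z_def)
  qed
  then show ?thesis
    using torus_mean_abs_shift[OF F, of \<alpha>] by (simp add: torus_H_def torus_mean_def F_def)
qed

lemma torus_H_scaleR: "torus_H \<omega> (c *\<^sub>R p) = \<bar>c\<bar> * torus_H \<omega> p"
  by (simp add: torus_H_eq torus_form_scaleR abs_mult torus_mean_scale)

lemma torus_H_triangle: "torus_H \<omega> (p + q) \<le> torus_H \<omega> p + torus_H \<omega> q"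
proof -
  have "torus_mean (\<lambda>\<phi>. \<bar>torus_form \<omega> (p + q) \<phi>\<bar>) \<le> torus_mean (\<lambda>\<phi>. \<bar>torus_form \<omega> p \<phi>\<bar> + \<bar>torus_form \<omega> q \<phi>\<bar>)"
    by (rule torus_mean_mono) (auto intro!: continuous_intros continuous_on_torus_form simp: torus_form_add)
  then show ?thesis
    by (simp add: torus_H_eq torus_mean_add continuous_on_torus_form continuous_on_rabs)
qed

lemma torus_H_nonneg: "torus_H \<omega> p \<ge> 0"
proof -
  have "torus_mean (\<lambda>_ :: real ^ 'a. 0) \<le> torus_mean (\<lambda>\<phi>. \<bar>torus_form \<omega> p \<phi>\<bar>)"
    by (rule torus_mean_mono) (auto intro!: continuous_intros continuous_on_torus_form)
  then show ?thesis by (simp add: torus_H_eq torus_mean_const)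
qed

text \<open>A Lipschitz constant, with respect to the Euclidean norm, of \<open>torus_form \<omega> p \<phi>\<close> as a function of
  \<open>p\<close>, uniform in \<open>\<phi>\<close>.\<close>

definition form_bound :: "real ^ 'n::finite \<Rightarrow> real" where
  "form_bound \<omega> = (\<Sum>i\<in>UNIV. 1 + 1 / \<bar>\<omega> $ i\<bar>)"

lemma form_bound_nonneg: "form_bound \<omega> \<ge> 0"
  by (simp add: form_bound_def sum_nonneg)

lemma abs_torus_form_le: "\<bar>torus_form \<omega> p \<phi>\<bar> \<le> form_bound \<omega> * norm p"
proof -
  have "\<bar>torus_form \<omega> p \<phi>\<bar> \<le> (\<Sum>i\<in>UNIV. (1 + 1 / \<bar>\<omega> $ i\<bar>) * norm p)"
    unfolding torus_form_def
  proof (rule order_trans[OF sum_abs sum_mono])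
    fix i
    have n: "\<bar>snd (p $ i)\<bar> \<le> norm p" "\<bar>fst (p $ i)\<bar> \<le> norm p"
      using norm_snd_le[of "snd (p $ i)" "fst (p $ i)"] norm_fst_le[of "fst (p $ i)" "snd (p $ i)"]
        Finite_Cartesian_Product.norm_nth_le[of p i]
      by simp_all
    have "\<bar>snd (p $ i) * cos (\<phi> $ i)\<bar> \<le> norm p * 1"
      unfolding abs_mult using n by (intro mult_mono) auto
    moreover have "\<bar>fst (p $ i) / \<omega> $ i * sin (\<phi> $ i)\<bar> \<le> norm p / \<bar>\<omega> $ i\<bar> * 1"
      unfolding abs_mult abs_divide using n by (intro mult_mono divide_right_mono) auto
    ultimately show "\<bar>snd (p $ i) * cos (\<phi> $ i) + fst (p $ i) / \<omega> $ i * sin (\<phi> $ i)\<bar> \<le> (1 + 1 / \<bar>\<omega> $ i\<bar>) * norm p"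
      using abs_triangle_ineq[of "snd (p $ i) * cos (\<phi> $ i)" "fst (p $ i) / \<omega> $ i * sin (\<phi> $ i)"]
      by (simp only: distrib_right) simp
  qed
  then show ?thesis by (simp add: form_bound_def sum_distrib_right)
qed

lemma torus_H_le: "torus_H \<omega> p \<le> form_bound \<omega> * norm p"
proof -
  have "torus_mean (\<lambda>\<phi>. \<bar>torus_form \<omega> p \<phi>\<bar>) \<le> torus_mean (\<lambda>_ :: real ^ 'a. form_bound \<omega> * norm p)"
    by (rule torus_mean_mono) (auto intro!: continuous_intros continuous_on_torus_form abs_torus_form_le)
  then show ?thesis by (simp add: torus_H_eq torus_mean_const)
qed

lemma torus_H_diff_le: "\<bar>torus_H \<omega> p - torus_H \<omega> q\<bar> \<le> form_bound \<omega> * norm (p - q)"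
proof -
  have "torus_H \<omega> p - torus_H \<omega> q \<le> form_bound \<omega> * norm (p - q)" for p q
    using torus_H_triangle[of \<omega> "p - q" q] torus_H_le[of \<omega> "p - q"] by simp
  from this[of p q] this[of q p] show ?thesis by (simp add: norm_minus_commute)
qed

lemma continuous_on_torus_H: "continuous_on S (torus_H \<omega>)"
proof (rule lipschitz_on_continuous_on)
  show "(form_bound \<omega>)-lipschitz_on S (torus_H \<omega>)"
    using torus_H_diff_le form_bound_nonneg by (auto intro!: lipschitz_onI simp: dist_norm)
qed

lemma cube_realises_unit_vectors:
  fixes u :: "'n::finite \<Rightarrow> complex"
  assumes "\<And>i. cmod (u i) = 1"
  obtains \<phi> :: "real ^ 'n" where "\<phi> \<in> cbox 0 (\<chi> i. 2 * pi)" "\<And>i. cos (\<phi> $ i) = Re (u i)" "\<And>i. sin (\<phi> $ i) = Im (u i)"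
proof -
  have "\<exists>t. 0 \<le> t \<and> t < 2 * pi \<and> Re (u i) = cos t \<and> Im (u i) = sin t" for i
    using sincos_total_2pi[of "Re (u i)" "Im (u i)"] assms[of i] by (metis cmod_power2 power_one)
  then obtain t where t: "\<And>i. 0 \<le> t i \<and> t i < 2 * pi \<and> Re (u i) = cos (t i) \<and> Im (u i) = sin (t i)" by metis
  show thesis
    by (rule that[of "\<chi> i. t i"]) (use t in \<open>auto simp: mem_box_cart less_imp_le\<close>)
qed

lemma torus_H_eq_0_imp:
  assumes "\<And>i. \<omega> $ i > 0" "torus_H \<omega> p = 0" shows "p = 0"
proof -
  have z: "torus_form \<omega> p \<phi> = 0" if "\<phi> \<in> cbox 0 (\<chi> i. 2 * pi)" for \<phi>
    using torus_mean_eq_0_imp[of "\<lambda>\<phi>. \<bar>torus_form \<omega> p \<phi>\<bar>" \<phi>] assms(2) that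
    by (auto simp: torus_H_eq intro!: continuous_intros continuous_on_torus_form)
  \<comment> \<open>the point of the torus where the form attains its maximum \<open>\<Sum>\<^sub>i z\<^sub>i\<close>\<close>
  define u where "u i = (let w = Complex (snd (p $ i)) (fst (p $ i) / \<omega> $ i) in if w = 0 then 1 else sgn w)" for i
  have "cmod (u i) = 1" for i by (simp add: u_def Let_def norm_sgn)
  then obtain \<phi> :: "real ^ 'a" where \<phi>: "\<phi> \<in> cbox 0 (\<chi> i. 2 * pi)"
      "\<And>i. cos (\<phi> $ i) = Re (u i)" "\<And>i. sin (\<phi> $ i) = Im (u i)"
    by (rule cube_realises_unit_vectors[of u]) blast
  have inner: "snd (p $ i) * Re (u i) + fst (p $ i) / \<omega> $ i * Im (u i) = cmod (Complex (snd (p $ i)) (fst (p $ i) / \<omega> $ i))" for i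
  proof -
    define w where "w = Complex (snd (p $ i)) (fst (p $ i) / \<omega> $ i)"
    have "snd (p $ i) * Re (u i) + fst (p $ i) / \<omega> $ i * Im (u i) = w \<bullet> u i"
      by (simp add: w_def inner_complex_def)
    also have "\<dots> = norm w"
      by (cases "w = 0") (simp_all add: u_def w_def[symmetric] sgn_div_norm dot_square_norm power2_eq_square)
    finally show ?thesis by (simp add: w_def)
  qed
  have "(\<Sum>i\<in>UNIV. cmod (Complex (snd (p $ i)) (fst (p $ i) / \<omega> $ i))) = 0"
    using z[OF \<phi>(1)] by (simp only: torus_form_def \<phi>(2,3) inner)
  then have c0: "cmod (Complex (snd (p $ i)) (fst (p $ i) / \<omega> $ i)) = 0" for i
    by (simp add: sum_nonneg_eq_0_iff)
  have "p $ i = 0" for i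
    using assms(1)[of i] c0[of i] by (simp add: complex_eq_iff prod_eq_iff)
  then show ?thesis by (simp add: vec_eq_iff)
qed

lemma torus_H_ge_norm:
  assumes "\<And>i. \<omega> $ i > 0"
  obtains c where "c > 0" "\<And>p. c * norm p \<le> torus_H \<omega> p"
proof -
  have "sphere (0 :: 'a phase) 1 \<noteq> {}" using vector_choose_size[of 1] by (auto simp: sphere_def)
  then obtain p0 where p0: "norm p0 = 1" "\<And>p. norm p = 1 \<Longrightarrow> torus_H \<omega> p0 \<le> torus_H \<omega> p"
    using continuous_attains_inf[OF compact_sphere _ continuous_on_torus_H, of 0 1 \<omega>] by auto
  have "torus_H \<omega> p0 \<noteq> 0" using torus_H_eq_0_imp[OF assms, of p0] p0(1) by auto
  then have pos: "torus_H \<omega> p0 > 0" using torus_H_nonneg[of \<omega> p0] by simp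
  show thesis
  proof (rule that[OF pos])
    fix p :: "'a phase"
    show "torus_H \<omega> p0 * norm p \<le> torus_H \<omega> p"
    proof (cases "p = 0")
      case False
      then have "torus_H \<omega> p0 \<le> torus_H \<omega> ((1 / norm p) *\<^sub>R p)" by (intro p0) simp
      then show ?thesis using False by (simp add: torus_H_scaleR field_simps)
    qed (simp add: torus_H_nonneg)
  qed
qed

text \<open>If \<open>s\<close> is the component of \<open>b\<close> orthogonal to \<open>a\<close>, moving from \<open>s\<close> slightly against \<open>a\<close> makes the pairing
  with \<open>a\<close> negative while the pairing with \<open>b\<close> stays close to \<open>s \<bullet> s\<close>.\<close>

lemma parallel_if_inner_same_sign:
  fixes a b :: "'a::real_inner"
  assumes same: "\<And>s. (a \<bullet> s) * (b \<bullet> s) \<ge> 0" and "a \<noteq> 0"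
  obtains l where "b = l *\<^sub>R a"
proof -
  define l where "l = (a \<bullet> b) / (a \<bullet> a)"
  define s where "s = b - l *\<^sub>R a"
  have aa: "a \<bullet> a > 0" using \<open>a \<noteq> 0\<close> by simp
  have as: "a \<bullet> s = 0" using aa by (simp add: s_def l_def inner_diff_right)
  have bs: "b \<bullet> s = s \<bullet> s" using as by (simp add: s_def inner_diff_left inner_diff_right inner_commute)
  have "s \<bullet> s \<le> 0 + \<tau>" if "\<tau> > 0" for \<tau>
  proof -
    define r where "r = \<tau> / (\<bar>a \<bullet> b\<bar> + 1)"
    have "r > 0" using that by (simp add: r_def)
    have "a \<bullet> (s - r *\<^sub>R a) < 0" using as aa \<open>r > 0\<close> by (simp add: inner_diff_right)
    then have "b \<bullet> (s - r *\<^sub>R a) \<le> 0" using same[of "s - r *\<^sub>R a"] by (simp add: zero_le_mult_iff)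
    then have "s \<bullet> s \<le> r * (a \<bullet> b)" by (simp add: inner_diff_right bs inner_commute)
    also have "\<dots> \<le> r * (\<bar>a \<bullet> b\<bar> + 1)" using \<open>r > 0\<close> by (intro mult_left_mono) auto
    also have "\<dots> = \<tau>" by (simp add: r_def)
    finally show ?thesis by simp
  qed
  then have "s \<bullet> s \<le> 0" by (rule field_le_epsilon)
  then have "s = 0" using inner_ge_zero[of s] inner_eq_zero_iff[of s] by linarith
  then show thesis using that[of l] by (simp add: s_def)
qed

text \<open>A circle is identified with the unit complex numbers. Relative to the directions \<open>e\<^sub>i\<close> of the \<open>P\<^sub>i\<close>,
  let \<open>b\<^sub>i\<close> and \<open>c\<^sub>i\<close> be the parallel and orthogonal components of \<open>Q\<^sub>i\<close>. Points \<open>u\<close> with every \<open>u\<^sub>i\<close> almost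
  orthogonal to \<open>e\<^sub>i\<close> show that all \<open>c\<^sub>i\<close> vanish; then the components of the \<open>u\<^sub>i\<close> along the \<open>e\<^sub>i\<close> range
  freely over a cube, which forces \<open>b\<close> to be proportional to \<open>a\<close>.\<close>

lemma torus_forms_same_sign_parallel:
  fixes P Q :: "'n::finite \<Rightarrow> complex"
  assumes same: "\<And>u. (\<And>i. cmod (u i) = 1) \<Longrightarrow> (\<Sum>i\<in>UNIV. P i \<bullet> u i) * (\<Sum>i\<in>UNIV. Q i \<bullet> u i) \<ge> 0"
    and nz: "P i0 \<noteq> 0"
  obtains l where "\<And>i. Q i = l *\<^sub>R P i"
proof -
  define e where "e i = (if P i = 0 then 1 else sgn (P i))" for i
  have e1: "cmod (e i) = 1" for i by (simp add: e_def norm_sgn)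
  define a b c where "a i = cmod (P i)" and "b i = Q i \<bullet> e i" and "c i = Q i \<bullet> (\<i> * e i)" for i
  have P: "P i = a i *\<^sub>R e i" for i by (simp add: a_def e_def sgn_div_norm)
  have ee: "(Re (e i))\<^sup>2 + (Im (e i))\<^sup>2 = 1" for i using e1[of i] by (metis cmod_power2 power_one)
  have Q: "Q i = (of_real (b i) + of_real (c i) * \<i>) * e i" for i
    using ee[of i] by (simp add: complex_eq_iff b_def c_def inner_complex_def) algebra
  have main: "(\<Sum>i\<in>UNIV. a i * x i) * (\<Sum>i\<in>UNIV. b i * x i + c i * y i) \<ge> 0"
    if xy: "\<And>i. (x i)\<^sup>2 + (y i)\<^sup>2 = 1" for x y :: "'n \<Rightarrow> real"
  proof -
    have "P i \<bullet> (Complex (x i) (y i) * e i) = a i * x i" for i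
      using ee[of i] by (simp add: P inner_complex_def) algebra
    moreover have "Q i \<bullet> (Complex (x i) (y i) * e i) = b i * x i + c i * y i" for i
      by (simp add: b_def c_def inner_complex_def) algebra
    moreover have "cmod (Complex (x i) (y i) * e i) = 1" for i
      by (simp add: norm_mult e1 complex_norm xy)
    ultimately show ?thesis
      using same[of "\<lambda>i. Complex (x i) (y i) * e i"] by simp
  qed
  have suma: "(\<Sum>i\<in>UNIV. a i) > 0"
    using nz by (intro sum_pos2[of _ i0]) (auto simp: a_def)
  have c0: "c i = 0" for i
  proof -
    have "((\<lambda>t. t * (\<Sum>i\<in>UNIV. b i) - sqrt (1 - t\<^sup>2) * (\<Sum>i\<in>UNIV. \<bar>c i\<bar>)) \<longlongrightarrow>
        0 * (\<Sum>i\<in>UNIV. b i) - sqrt (1 - 0\<^sup>2) * (\<Sum>i\<in>UNIV. \<bar>c i\<bar>)) (at_right 0)"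
      by (intro tendsto_intros)
    moreover have "\<forall>\<^sub>F t in at_right (0::real). 0 \<le> t * (\<Sum>i\<in>UNIV. b i) - sqrt (1 - t\<^sup>2) * (\<Sum>i\<in>UNIV. \<bar>c i\<bar>)"
      unfolding eventually_at_right_field
    proof (intro exI[of _ 1] conjI allI impI)
      fix t :: real assume t: "0 < t" "t < 1"
      then have t2: "t\<^sup>2 \<le> 1" by (simp add: power_le_one)
      \<comment> \<open>the signs are chosen so that \<open>c i * y i\<close> is never positive\<close>
      define y where "y i = (if c i \<ge> 0 then - sqrt (1 - t\<^sup>2) else sqrt (1 - t\<^sup>2))" for i
      have "(\<Sum>i\<in>UNIV. a i * t) * (\<Sum>i\<in>UNIV. b i * t + c i * y i) \<ge> 0"
        by (rule main) (use t2 in \<open>auto simp: y_def\<close>)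
      moreover have "(\<Sum>i\<in>UNIV. a i * t) > 0"
        using suma t by (simp add: sum_distrib_right[symmetric])
      ultimately have "(\<Sum>i\<in>UNIV. b i * t + c i * y i) \<ge> 0" by (simp add: zero_le_mult_iff)
      also have "(\<Sum>i\<in>UNIV. b i * t + c i * y i) = (\<Sum>i\<in>UNIV. t * b i - sqrt (1 - t\<^sup>2) * \<bar>c i\<bar>)"
        by (intro sum.cong) (auto simp: y_def)
      finally show "0 \<le> t * (\<Sum>i\<in>UNIV. b i) - sqrt (1 - t\<^sup>2) * (\<Sum>i\<in>UNIV. \<bar>c i\<bar>)"
        by (simp add: sum_subtractf sum_distrib_left)
    qed simp
    ultimately have "0 \<le> 0 * (\<Sum>i\<in>UNIV. b i) - sqrt (1 - 0\<^sup>2) * (\<Sum>i\<in>UNIV. \<bar>c i\<bar>)"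
      by (intro tendsto_lowerbound) auto
    then have "(\<Sum>i\<in>UNIV. \<bar>c i\<bar>) \<le> 0" by simp
    then have "(\<Sum>i\<in>UNIV. \<bar>c i\<bar>) = 0" by (intro antisym sum_nonneg) auto
    then show ?thesis by (simp add: sum_nonneg_eq_0_iff)
  qed
  have ineq: "((\<chi> i. a i) \<bullet> s) * ((\<chi> i. b i) \<bullet> s) \<ge> 0" for s :: "real ^ 'n"
  proof -
    define r where "r = 1 / (1 + norm s)"
    have r: "r > 0" by (simp add: r_def add_pos_nonneg)
    have "\<bar>r * s $ i\<bar> \<le> 1" for i
    proof -
      have "\<bar>s $ i\<bar> \<le> 1 + norm s" using component_le_norm_cart[of s i] by linarith
      then show ?thesis using r by (simp add: r_def abs_mult divide_simps)
    qed
    then have sq: "(r * s $ i)\<^sup>2 \<le> 1" for i by (simp add: abs_square_le_1)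
    have "(\<Sum>i\<in>UNIV. a i * (r * s $ i)) * (\<Sum>i\<in>UNIV. b i * (r * s $ i) + c i * sqrt (1 - (r * s $ i)\<^sup>2)) \<ge> 0"
      by (rule main) (use sq in simp)
    then have "(r * r) * (((\<chi> i. a i) \<bullet> s) * ((\<chi> i. b i) \<bullet> s)) \<ge> 0"
      by (simp add: c0 inner_vec_def sum_distrib_left sum_distrib_right algebra_simps)
    moreover have "r * r > 0" using r by simp
    ultimately show ?thesis by (metis not_less zero_le_mult_iff mult_less_0_iff)
  qed
  have "(\<chi> i. a i) \<noteq> (0 :: real ^ 'n)" using nz by (auto simp: vec_eq_iff a_def)
  from parallel_if_inner_same_sign[OF ineq this] obtain l where "(\<chi> i. b i) = l *\<^sub>R (\<chi> i. a i)" .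
  then have "b i = l * a i" for i by (simp add: vec_eq_iff)
  then have "Q i = l *\<^sub>R P i" for i by (simp add: Q c0 P scaleR_conv_of_real)
  then show thesis by (rule that)
qed

text \<open>Equality in the triangle inequality for \<open>H\<close> forces \<open>f\<^sub>p\<close> and \<open>f\<^sub>q\<close> to have the same sign everywhere on
  the torus.\<close>

lemma torus_H_strictly_convex:
  assumes pos: "\<And>i. \<omega> $ i > 0"
    and p: "torus_H \<omega> p = 1" and q: "torus_H \<omega> q = 1" and pq: "torus_H \<omega> (p + q) = 2"
  shows "p = q"
proof -
  let ?F = "\<lambda>\<phi>. \<bar>torus_form \<omega> p \<phi>\<bar> + \<bar>torus_form \<omega> q \<phi>\<bar> + (- 1) * \<bar>torus_form \<omega> (p + q) \<phi>\<bar>"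
  have cont: "continuous_on UNIV (\<lambda>\<phi>. \<bar>torus_form \<omega> p \<phi>\<bar>)" for p
    by (intro continuous_intros continuous_on_torus_form)
  have "torus_mean ?F = torus_H \<omega> p + torus_H \<omega> q + (- 1) * torus_H \<omega> (p + q)"
    unfolding torus_H_eq torus_mean_scale[symmetric]
    by (simp only: torus_mean_add cont continuous_on_add cont[THEN continuous_on_mult_left])
  then have mean0: "torus_mean ?F = 0" using p q pq by simp
  have zero: "?F \<phi> = 0" if "\<phi> \<in> cbox 0 (\<chi> i. 2 * pi)" for \<phi>
    using that mean0
    by (intro torus_mean_eq_0_imp[of ?F]) (auto intro!: continuous_intros continuous_on_torus_form simp: torus_form_add)
  have same: "torus_form \<omega> p \<phi> * torus_form \<omega> q \<phi> \<ge> 0" if "\<phi> \<in> cbox 0 (\<chi> i. 2 * pi)" for \<phi>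
    using zero[OF that] by (auto simp: torus_form_add zero_le_mult_iff)
  define w where "w p i = Complex (snd (p $ i)) (fst (p $ i) / \<omega> $ i)" for p :: "'a phase" and i
  have w: "torus_form \<omega> p \<phi> = (\<Sum>i\<in>UNIV. w p i \<bullet> u i)"
    if "\<And>i. cos (\<phi> $ i) = Re (u i)" "\<And>i. sin (\<phi> $ i) = Im (u i)" for p \<phi> u
    by (simp add: torus_form_def that w_def inner_complex_def)
  have "p \<noteq> 0" using p torus_H_scaleR[of \<omega> 0 p] by auto
  then obtain i0 where "p $ i0 \<noteq> 0" by (auto simp: vec_eq_iff)
  then have nz: "w p i0 \<noteq> 0"
    using pos[of i0] by (auto simp: w_def complex_eq_iff prod_eq_iff)
  have "(\<Sum>i\<in>UNIV. w p i \<bullet> u i) * (\<Sum>i\<in>UNIV. w q i \<bullet> u i) \<ge> 0" if "\<And>i. cmod (u i) = 1" for u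
  proof -
    obtain \<phi> :: "real ^ 'a" where \<phi>: "\<phi> \<in> cbox 0 (\<chi> i. 2 * pi)"
      "\<And>i. cos (\<phi> $ i) = Re (u i)" "\<And>i. sin (\<phi> $ i) = Im (u i)"
      using cube_realises_unit_vectors[of u] \<open>\<And>i. cmod (u i) = 1\<close> by metis
    show ?thesis using same[OF \<phi>(1)] by (simp add: w[OF \<phi>(2,3)])
  qed
  then obtain l where l: "\<And>i. w q i = l *\<^sub>R w p i"
    using torus_forms_same_sign_parallel[of "w p" "w q" i0] nz by metis
  have "q $ i = l *\<^sub>R p $ i" for i
    using l[of i] pos[of i] by (simp add: w_def complex_eq_iff prod_eq_iff)
  then have ql: "q = l *\<^sub>R p" by (simp add: vec_eq_iff)
  then have "\<bar>l\<bar> = 1" using p q by (simp add: torus_H_scaleR)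
  moreover have "p + q = (1 + l) *\<^sub>R p" by (simp add: ql algebra_simps)
  then have "\<bar>1 + l\<bar> = 2" using p pq by (simp add: torus_H_scaleR)
  ultimately have "l = 1" by linarith
  then show ?thesis using ql by simp
qed

text \<open>The mean of \<open>\<bar>f\<^sub>p\<bar>\<close> along the line \<open>s \<omega>\<close>, \<open>0 \<le> s \<le> L\<close>.\<close>

definition time_average :: "real ^ 'n \<Rightarrow> real \<Rightarrow> 'n::finite phase \<Rightarrow> real" where
  "time_average \<omega> L p = 1 / L * integral {0..L} (\<lambda>s. \<bar>torus_form \<omega> p (s *\<^sub>R \<omega>)\<bar>)"

lemma torus_form_line_continuous: "continuous_on S (\<lambda>s. torus_form \<omega> p (s *\<^sub>R \<omega>))"
  by (rule continuous_on_compose2[OF continuous_on_torus_form[of UNIV]]) (auto intro: continuous_intros)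

lemma time_average_diff_le:
  assumes "L > 0"
  shows "\<bar>time_average \<omega> L p - time_average \<omega> L q\<bar> \<le> form_bound \<omega> * norm (p - q)"
proof -
  have int: "(\<lambda>s. \<bar>torus_form \<omega> p (s *\<^sub>R \<omega>)\<bar>) integrable_on {0..L}" for p
    by (intro integrable_continuous_interval continuous_intros torus_form_line_continuous)
  have "norm (integral {0..L} (\<lambda>s. \<bar>torus_form \<omega> p (s *\<^sub>R \<omega>)\<bar> - \<bar>torus_form \<omega> q (s *\<^sub>R \<omega>)\<bar>))
      \<le> integral {0..L} (\<lambda>s. form_bound \<omega> * norm (p - q))"
  proof (intro integral_norm_bound_integral integrable_diff int)
    fix s
    show "norm (\<bar>torus_form \<omega> p (s *\<^sub>R \<omega>)\<bar> - \<bar>torus_form \<omega> q (s *\<^sub>R \<omega>)\<bar>) \<le> form_bound \<omega> * norm (p - q)"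
      using abs_torus_form_le[of \<omega> "p - q" "s *\<^sub>R \<omega>"] by (simp add: torus_form_diff)
  qed (rule integrable_const_ivl)
  then have "\<bar>integral {0..L} (\<lambda>s. \<bar>torus_form \<omega> p (s *\<^sub>R \<omega>)\<bar>) - integral {0..L} (\<lambda>s. \<bar>torus_form \<omega> q (s *\<^sub>R \<omega>)\<bar>)\<bar>
      \<le> form_bound \<omega> * norm (p - q) * L"
    using assms by (simp add: Henstock_Kurzweil_Integration.integral_diff[OF int int] mult_ac)
  then show ?thesis
    using assms by (simp add: time_average_def diff_divide_distrib[symmetric] abs_divide divide_le_eq)
qed

text \<open>Pointwise convergence is Weyl's theorem; the time averages share a Lipschitz constant with \<open>H\<close>, so a
  finite net of covectors gives uniformity on bounded sets.\<close>

lemma time_average_uniform_limit: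
  fixes \<omega> :: "real ^ 'n::finite"
  assumes nonres: "nonresonant \<omega>" and "e > 0"
  obtains L0 where "L0 > 0" "\<And>L p. L \<ge> L0 \<Longrightarrow> norm p \<le> R \<Longrightarrow> \<bar>time_average \<omega> L p - torus_H \<omega> p\<bar> \<le> e"
proof -
  define C where "C = form_bound \<omega> + 1"
  have C: "C > 0" using form_bound_nonneg[of \<omega>] by (simp add: C_def)
  define d where "d = e / (3 * C)"
  have "d > 0" using C \<open>e > 0\<close> by (simp add: d_def)
  obtain K where K: "finite K" "cball (0 :: 'n phase) R \<subseteq> (\<Union>q\<in>K. ball q d)"
    using compact_cball[of "0 :: 'n phase" R] \<open>d > 0\<close> unfolding compact_eq_totally_bounded by metis
  have "\<forall>\<^sub>F L in at_top. \<forall>q\<in>K. dist (time_average \<omega> L q) (torus_H \<omega> q) < e / 3"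
    unfolding eventually_ball_finite_distrib[OF K(1)]
  proof
    fix q
    have "((\<lambda>L. time_average \<omega> L q) \<longlongrightarrow> torus_H \<omega> q) at_top"
      unfolding time_average_def torus_H_eq by (rule abs_time_average[OF nonres torus_form_trig_poly])
    then show "\<forall>\<^sub>F L in at_top. dist (time_average \<omega> L q) (torus_H \<omega> q) < e / 3"
      using \<open>e > 0\<close> by (intro tendstoD) auto
  qed
  then obtain L1 where L1: "\<And>L q. L \<ge> L1 \<Longrightarrow> q \<in> K \<Longrightarrow> \<bar>time_average \<omega> L q - torus_H \<omega> q\<bar> < e / 3"
    by (auto simp: eventually_at_top_linorder dist_real_def)
  show thesis
  proof (rule that[of "max L1 1"])
    fix L and p :: "'n phase" assume L: "L \<ge> max L1 1" and "norm p \<le> R"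
    then obtain q where q: "q \<in> K" "norm (p - q) < d"
      using K(2) by (auto simp: subset_iff dist_norm norm_minus_commute)
    have "form_bound \<omega> * norm (p - q) \<le> C * d"
      using q(2) form_bound_nonneg[of \<omega>] by (intro mult_mono) (auto simp: C_def)
    also have "\<dots> = e / 3" using C by (simp add: d_def)
    finally have small: "form_bound \<omega> * norm (p - q) \<le> e / 3" .
    show "\<bar>time_average \<omega> L p - torus_H \<omega> p\<bar> \<le> e"
      using time_average_diff_le[of L \<omega> p q] torus_H_diff_le[of \<omega> p q] L1[OF _ q(1), of L] L small
      by linarith
  qed simp
qed

section \<open>The dual norm and its gradient\<close>

locale oscillators =
  fixes \<omega> :: "real ^ 'n::finite"
  assumes pos: "\<And>i. \<omega> $ i > 0"
begin

abbreviation H :: "'n phase \<Rightarrow> real" where "H \<equiv> torus_H \<omega>"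

abbreviation \<rho> :: "'n phase \<Rightarrow> real" where "\<rho> \<equiv> dual_norm \<omega>"

lemma H_unit_ball_bounded: obtains R where "R > 0" "\<And>p. H p \<le> 1 \<Longrightarrow> norm p \<le> R"
proof -
  obtain c where c: "c > 0" "\<And>p. c * norm p \<le> H p" using torus_H_ge_norm[of \<omega>] pos by blast
  have "norm p \<le> 1 / c" if "H p \<le> 1" for p
    using c(1) order_trans[OF c(2) that] by (simp add: field_simps)
  then show thesis using that[of "1 / c"] c(1) by simp
qed

lemma H_unit_ball_compact: "compact {p. H p \<le> 1}"
proof -
  obtain R where R: "\<And>p. H p \<le> 1 \<Longrightarrow> norm p \<le> R" using H_unit_ball_bounded by metis
  have "closed {p. H p \<le> 1}"
    by (intro closed_Collect_le continuous_on_torus_H continuous_on_const)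
  moreover have "bounded {p. H p \<le> 1}" using R by (auto simp: bounded_iff)
  ultimately show ?thesis by (simp add: compact_eq_bounded_closed)
qed

lemma H_0: "H 0 = 0"
  using torus_H_scaleR[of \<omega> 0 0] by simp

text \<open>A covector in the unit ball of \<open>H\<close> at which the maximum defining \<open>\<rho>(x)\<close> is attained. For \<open>x \<noteq> 0\<close> it
  is unique, and it is the gradient of \<open>\<rho>\<close> at \<open>x\<close>; at 0 it is arbitrary.\<close>

definition maximiser :: "'n phase \<Rightarrow> 'n phase" where
  "maximiser x = (SOME p. H p \<le> 1 \<and> (\<forall>q. H q \<le> 1 \<longrightarrow> x \<bullet> q \<le> x \<bullet> p))"

lemma maximiser: "H (maximiser x) \<le> 1" "H q \<le> 1 \<Longrightarrow> x \<bullet> q \<le> x \<bullet> maximiser x"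
proof -
  have "\<exists>p\<in>{p. H p \<le> 1}. \<forall>q\<in>{p. H p \<le> 1}. x \<bullet> q \<le> x \<bullet> p"
    using H_0 by (intro continuous_attains_sup H_unit_ball_compact) (auto intro!: continuous_intros exI[of _ 0])
  then have "\<exists>p. H p \<le> 1 \<and> (\<forall>q. H q \<le> 1 \<longrightarrow> x \<bullet> q \<le> x \<bullet> p)" by auto
  from someI_ex[OF this] show "H (maximiser x) \<le> 1" "H q \<le> 1 \<Longrightarrow> x \<bullet> q \<le> x \<bullet> maximiser x"
    by (auto simp: maximiser_def)
qed

lemma dual_norm_eq: "\<rho> x = x \<bullet> maximiser x"
  unfolding dual_norm_def
  by (rule cSup_eq_maximum) (use maximiser in auto)

lemma inner_le_dual_norm: "H q \<le> 1 \<Longrightarrow> x \<bullet> q \<le> \<rho> x"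
  unfolding dual_norm_eq by (rule maximiser)

lemma dual_norm_pos:
  assumes "x \<noteq> 0" shows "\<rho> x > 0"
proof -
  have "H x > 0"
    using torus_H_eq_0_imp[of \<omega> x] pos torus_H_nonneg[of \<omega> x] assms by force
  then have "H ((1 / H x) *\<^sub>R x) \<le> 1" by (simp add: torus_H_scaleR)
  from inner_le_dual_norm[OF this, of x] have "x \<bullet> x / H x \<le> \<rho> x" by simp
  moreover have "x \<bullet> x / H x > 0" using \<open>H x > 0\<close> assms by simp
  ultimately show ?thesis by linarith
qed

lemma H_maximiser:
  assumes "x \<noteq> 0" "H p \<le> 1" "x \<bullet> p = \<rho> x"
  shows "H p = 1"
proof (rule ccontr)
  assume "H p \<noteq> 1"
  have "p \<noteq> 0" using dual_norm_pos[OF assms(1)] assms(3) by auto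
  then have h: "0 < H p" "H p < 1"
    using torus_H_eq_0_imp[of \<omega> p] pos torus_H_nonneg[of \<omega> p] assms(2) \<open>H p \<noteq> 1\<close> by force+
  then have "H ((1 / H p) *\<^sub>R p) \<le> 1" by (simp add: torus_H_scaleR)
  from inner_le_dual_norm[OF this, of x] have "\<rho> x / H p \<le> \<rho> x" using assms(3) by simp
  then have "\<rho> x \<le> \<rho> x * H p" using h by (simp add: field_simps)
  then show False using dual_norm_pos[OF assms(1)] h by (simp add: mult_le_cancel_left1)
qed

lemma maximiser_unique:
  assumes x: "x \<noteq> 0" and p: "H p \<le> 1" "x \<bullet> p = \<rho> x"
  shows "maximiser x = p"
proof -
  let ?q = "maximiser x"
  have q: "H ?q \<le> 1" "x \<bullet> ?q = \<rho> x" by (auto simp: maximiser dual_norm_eq)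
  let ?m = "(1 / 2) *\<^sub>R (?q + p)"
  have "H ?m \<le> 1" using torus_H_triangle[of \<omega> ?q p] p(1) q(1) by (simp add: torus_H_scaleR)
  moreover have "x \<bullet> ?m = \<rho> x" using p(2) q(2) by (simp add: inner_add_right)
  ultimately have "H ?m = 1" by (rule H_maximiser[OF x])
  then have "H (?q + p) = 2" by (simp add: torus_H_scaleR)
  then show ?thesis
    using H_maximiser[OF x p] H_maximiser[OF x q] pos by (intro torus_H_strictly_convex[of \<omega>])
qed

lemma maximiser_scaleR:
  assumes "c > 0" shows "maximiser (c *\<^sub>R x) = maximiser x"
proof (cases "x = 0")
  case False
  have "\<rho> (c *\<^sub>R x) = c * \<rho> x"
  proof (rule antisym)
    show "c * \<rho> x \<le> \<rho> (c *\<^sub>R x)"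
      using inner_le_dual_norm[OF maximiser(1)[of x], of "c *\<^sub>R x"] by (simp add: dual_norm_eq[of x])
    show "\<rho> (c *\<^sub>R x) \<le> c * \<rho> x"
      using assms inner_le_dual_norm[OF maximiser(1)[of "c *\<^sub>R x"], of x] by (simp add: dual_norm_eq[of "c *\<^sub>R x"])
  qed
  then show ?thesis
    using assms False by (intro maximiser_unique) (auto simp: maximiser dual_norm_eq[of x])
qed simp

text \<open>The graph is closed and the values lie in a compact set. Continuity away from the origin follows from
  homogeneity.\<close>

lemma continuous_on_maximiser: "continuous_on (sphere 0 1) maximiser"
proof -
  let ?K = "{p. H p \<le> 1}" and ?S = "sphere (0 :: 'n phase) 1"
  have "(\<lambda>x. (x, maximiser x)) ` ?S = (?S \<times> ?K) \<inter> {z. \<forall>q\<in>?K. fst z \<bullet> q \<le> fst z \<bullet> snd z}"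
  proof (intro equalityI subsetI)
    fix z assume z: "z \<in> (?S \<times> ?K) \<inter> {z. \<forall>q\<in>?K. fst z \<bullet> q \<le> fst z \<bullet> snd z}"
    then have "fst z \<bullet> snd z = \<rho> (fst z)"
      using inner_le_dual_norm[of "snd z" "fst z"] maximiser(1)[of "fst z"]
      by (auto simp: dual_norm_eq intro!: antisym)
    moreover have "fst z \<noteq> 0" using z by auto
    ultimately have "maximiser (fst z) = snd z" using z by (intro maximiser_unique) auto
    then show "z \<in> (\<lambda>x. (x, maximiser x)) ` ?S" using z by (auto simp: image_iff prod_eq_iff)
  qed (use maximiser in auto)
  moreover have "closed {z :: 'n phase \<times> 'n phase. \<forall>q\<in>?K. fst z \<bullet> q \<le> fst z \<bullet> snd z}"
    unfolding Ball_def
    by (intro closed_Collect_all closed_Collect_imp closed_Collect_le open_Collect_const continuous_intros)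
  ultimately have "closedin (top_of_set (?S \<times> ?K)) ((\<lambda>x. (x, maximiser x)) ` ?S)"
    by (simp add: closedin_closed_Int)
  then show ?thesis
    using continuous_closed_graph_eq[OF H_unit_ball_compact, of maximiser ?S] maximiser(1) by auto
qed

lemma maximiser_uniformly_close:
  assumes "d > 0" "D \<ge> 0"
  obtains R where "R > 0"
    "\<And>x y. norm x \<ge> R \<Longrightarrow> norm (x - y) \<le> D \<Longrightarrow> y \<noteq> 0 \<and> norm (maximiser x - maximiser y) < d"
proof -
  have "uniformly_continuous_on (sphere 0 1) maximiser"
    by (intro compact_uniformly_continuous continuous_on_maximiser compact_sphere)
  then obtain r where r: "r > 0"
    "\<And>x y. norm x = 1 \<Longrightarrow> norm y = 1 \<Longrightarrow> norm (x - y) < r \<Longrightarrow> norm (maximiser x - maximiser y) < d"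
    using assms(1) unfolding uniformly_continuous_on_def dist_norm by (metis mem_sphere_0)
  \<comment> \<open>normalising \<open>x\<close> and \<open>y\<close> turns a distance \<open>D\<close> into at most \<open>2 D / R\<close>\<close>
  define R where "R = D + 1 + 2 * D / r"
  have R: "R > D" "R > 0" "2 * D < r * R"
    using r(1) assms(2) by (auto simp: R_def field_simps add_pos_nonneg)
  show thesis
  proof (rule that[OF R(2)])
    fix x y :: "'n phase" assume xy: "norm x \<ge> R" "norm (x - y) \<le> D"
    have "y \<noteq> 0" using xy R by auto
    have "x \<noteq> 0" using xy R by auto
    define u v where "u = (1 / norm x) *\<^sub>R x" and "v = (1 / norm y) *\<^sub>R y"
    have uv: "norm u = 1" "norm v = 1" using \<open>x \<noteq> 0\<close> \<open>y \<noteq> 0\<close> by (auto simp: u_def v_def)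
    have "norm x *\<^sub>R (u - v) = (x - y) + (norm y - norm x) *\<^sub>R v"
      using \<open>x \<noteq> 0\<close> \<open>y \<noteq> 0\<close> by (simp add: u_def v_def algebra_simps)
    then have "norm x * norm (u - v) = norm ((x - y) + (norm y - norm x) *\<^sub>R v)"
      by (metis norm_scaleR abs_norm_cancel)
    also have "\<dots> \<le> norm (x - y) + \<bar>norm y - norm x\<bar>"
      using norm_triangle_ineq[of "x - y" "(norm y - norm x) *\<^sub>R v"] uv by simp
    also have "\<dots> \<le> 2 * D" using norm_triangle_ineq3[of x y] xy by simp
    also have "\<dots> < r * R" by (rule R(3))
    also have "\<dots> \<le> norm x * r" using xy r(1) by (simp add: mult.commute)
    finally have "norm (u - v) < r" using \<open>x \<noteq> 0\<close> by simp
    then have "norm (maximiser u - maximiser v) < d" using r(2) uv by blast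
    then show "y \<noteq> 0 \<and> norm (maximiser x - maximiser y) < d"
      using \<open>x \<noteq> 0\<close> \<open>y \<noteq> 0\<close> by (simp add: u_def v_def maximiser_scaleR)
  qed
qed

lemma isCont_maximiser:
  assumes "x \<noteq> 0" shows "isCont maximiser x"
  unfolding isCont_def
proof (rule tendstoI)
  fix d :: real assume "d > 0"
  from maximiser_uniformly_close[OF this, of 1] obtain R where R: "R > 0"
    "\<And>x y. norm x \<ge> R \<Longrightarrow> norm (x - y) \<le> 1 \<Longrightarrow> y \<noteq> 0 \<and> norm (maximiser x - maximiser y) < d"
    by (metis zero_le_one)
  define c where "c = R / norm x"
  have c: "c > 0" using R assms by (simp add: c_def)
  show "\<forall>\<^sub>F y in at x. dist (maximiser y) (maximiser x) < d"
    unfolding eventually_at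
  proof (intro exI[of _ "1 / c"] conjI ballI impI)
    fix y assume y: "y \<noteq> x \<and> dist y x < 1 / c"
    have "norm (c *\<^sub>R x - c *\<^sub>R y) \<le> 1"
    proof -
      have "norm (c *\<^sub>R x - c *\<^sub>R y) = norm (c *\<^sub>R (x - y))" by (simp only: scaleR_diff_right)
      also have "\<dots> = c * dist y x" using c by (simp add: dist_norm norm_minus_commute)
      also have "\<dots> \<le> c * (1 / c)" using c y by (intro mult_left_mono) auto
      finally show ?thesis using c by simp
    qed
    moreover have "norm (c *\<^sub>R x) \<ge> R" using assms R by (simp add: c_def)
    ultimately have "norm (maximiser (c *\<^sub>R x) - maximiser (c *\<^sub>R y)) < d" using R(2) by blast
    then show "dist (maximiser y) (maximiser x) < d"
      using c by (simp add: maximiser_scaleR dist_norm norm_minus_commute)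
  qed (use c in simp)
qed

text \<open>The remainder \<open>\<rho>(y) - \<rho>(x) - \<langle>y - x, maximiser x\<rangle>\<close> lies between 0 and
  \<open>\<langle>y - x, maximiser y - maximiser x\<rangle>\<close>.\<close>

lemma gderiv_dual_norm:
  assumes "x \<noteq> 0" shows "GDERIV \<rho> x :> maximiser x"
  unfolding gderiv_def has_derivative_at_within
proof (intro conjI)
  show "bounded_linear (\<lambda>h. h \<bullet> maximiser x)" by (rule bounded_linear_inner_left)
  have "((\<lambda>y. norm (maximiser y - maximiser x)) \<longlongrightarrow> 0) (at x)"
    using isCont_maximiser[OF assms] by (simp add: isCont_def LIM_zero tendsto_norm_zero)
  then show "((\<lambda>y. (\<rho> y - \<rho> x - (y - x) \<bullet> maximiser x) /\<^sub>R norm (y - x)) \<longlongrightarrow> 0) (at x)"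
  proof (rule Lim_null_comparison[rotated])
    show "\<forall>\<^sub>F y in at x. norm ((\<rho> y - \<rho> x - (y - x) \<bullet> maximiser x) /\<^sub>R norm (y - x))
        \<le> norm (maximiser y - maximiser x)"
      using eventually_neq_at_within[of x x UNIV]
    proof eventually_elim
      case (elim y)
      define r where "r = \<rho> y - \<rho> x - (y - x) \<bullet> maximiser x"
      have "r \<ge> 0"
        using inner_le_dual_norm[OF maximiser(1)[of x], of y] by (simp add: r_def dual_norm_eq[of x] inner_diff_left)
      have "r \<le> (y - x) \<bullet> (maximiser y - maximiser x)"
        using inner_le_dual_norm[OF maximiser(1)[of y], of x]
        by (simp add: r_def dual_norm_eq[of y] inner_diff_left inner_diff_right)
      also have "\<dots> \<le> norm (y - x) * norm (maximiser y - maximiser x)" by (rule norm_cauchy_schwarz)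
      finally have "\<bar>r\<bar> \<le> norm (y - x) * norm (maximiser y - maximiser x)" using \<open>r \<ge> 0\<close> by simp
      then show ?case using elim by (simp add: r_def[symmetric] abs_mult divide_simps mult.commute)
    qed
  qed
qed

lemma gradient_dual_norm:
  assumes "x \<noteq> 0" shows "gradient \<rho> x = maximiser x"
  unfolding gradient_def
proof (rule the_equality)
  show "GDERIV \<rho> x :> maximiser x" by (rule gderiv_dual_norm[OF assms])
  fix D assume "GDERIV \<rho> x :> D"
  then have "(\<lambda>h. h \<bullet> D) = (\<lambda>h. h \<bullet> maximiser x)"
    using gderiv_dual_norm[OF assms] unfolding gderiv_def by (rule has_derivative_unique)
  then have "h \<bullet> D = h \<bullet> maximiser x" for h by (rule fun_cong)
  then show "D = maximiser x" using vector_eq_ldot[of D "maximiser x"] by blast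
qed

lemma dual_norm_le_norm: obtains R where "R > 0" "\<And>x. \<rho> x \<le> R * norm x"
proof -
  obtain R where R: "R > 0" "\<And>p. H p \<le> 1 \<Longrightarrow> norm p \<le> R" using H_unit_ball_bounded by metis
  have "\<rho> x \<le> R * norm x" for x
  proof -
    have "\<rho> x \<le> norm x * norm (maximiser x)" unfolding dual_norm_eq by (rule norm_cauchy_schwarz)
    also have "\<dots> \<le> norm x * R" using R(2)[OF maximiser(1)] by (intro mult_left_mono) auto
    finally show ?thesis by (simp add: mult.commute)
  qed
  then show thesis using that R(1) by blast
qed

end

section \<open>The free flow\<close>

text \<open>The uncontrolled flow \<open>exp(s A)\<close> on states.\<close>

definition state_flow :: "real ^ 'n \<Rightarrow> real \<Rightarrow> 'n::finite phase \<Rightarrow> 'n phase" where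
  "state_flow \<omega> s x = (\<chi> i.
     (fst (x $ i) * cos (\<omega> $ i * s) + snd (x $ i) / \<omega> $ i * sin (\<omega> $ i * s),
      snd (x $ i) * cos (\<omega> $ i * s) - \<omega> $ i * fst (x $ i) * sin (\<omega> $ i * s)))"

text \<open>The adjoint flow \<open>exp(s A*)\<close> on covectors.\<close>

definition covector_flow :: "real ^ 'n \<Rightarrow> real \<Rightarrow> 'n::finite phase \<Rightarrow> 'n phase" where
  "covector_flow \<omega> s p = (\<chi> i.
     (fst (p $ i) * cos (\<omega> $ i * s) - \<omega> $ i * snd (p $ i) * sin (\<omega> $ i * s),
      snd (p $ i) * cos (\<omega> $ i * s) + fst (p $ i) / \<omega> $ i * sin (\<omega> $ i * s)))"

text \<open>The adjoint \<open>A*\<close> of \<open>osc_A \<omega>\<close>.\<close>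

definition osc_adjoint :: "real ^ 'n \<Rightarrow> 'n::finite phase \<Rightarrow> 'n phase" where
  "osc_adjoint \<omega> p = (\<chi> i. (- (\<omega> $ i)\<^sup>2 * snd (p $ i), fst (p $ i)))"

lemma inner_osc_A: "osc_A \<omega> x \<bullet> p = x \<bullet> osc_adjoint \<omega> p"
  by (simp add: osc_A_def osc_adjoint_def inner_vec_def inner_prod_def algebra_simps)

lemma inner_osc_B_covector_flow: "osc_B \<bullet> covector_flow \<omega> s p = torus_form \<omega> p (s *\<^sub>R \<omega>)"
  by (simp add: osc_B_def covector_flow_def torus_form_def inner_vec_def inner_prod_def mult.commute)

lemma inner_state_flow: "state_flow \<omega> s x \<bullet> p = x \<bullet> covector_flow \<omega> s p"
  unfolding state_flow_def covector_flow_def inner_vec_def inner_prod_def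
  by (intro sum.cong) (simp_all add: algebra_simps)

lemma covector_flow_0: "covector_flow \<omega> 0 p = p"
  by (simp add: covector_flow_def vec_eq_iff)

lemma covector_flow_minus: "covector_flow \<omega> s (- p) = - covector_flow \<omega> s p"
  by (simp add: covector_flow_def vec_eq_iff algebra_simps)

lemma torus_form_minus: "torus_form \<omega> (- p) \<phi> = - torus_form \<omega> p \<phi>"
  using torus_form_scaleR[of \<omega> "-1" p \<phi>] by simp

lemma has_vector_derivative_covector_flow:
  assumes "\<And>i. \<omega> $ i > 0"
  shows "((\<lambda>s. covector_flow \<omega> s p) has_vector_derivative osc_adjoint \<omega> (covector_flow \<omega> s p)) (at s)"
  unfolding has_vector_derivative_def
proof (subst has_derivative_componentwise_within, intro ballI)
  fix b :: "'a phase" assume "b \<in> Basis"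
  then obtain i and u :: "real \<times> real" where b: "b = axis i u" "u \<in> Basis" by (auto simp: Basis_vec_def)
  have nz: "\<omega> $ i \<noteq> 0" using assms[of i] by simp
  have "((\<lambda>x. covector_flow \<omega> x p $ i \<bullet> u) has_real_derivative osc_adjoint \<omega> (covector_flow \<omega> s p) $ i \<bullet> u) (at s)"
    using b(2) nz unfolding Basis_prod_def
    by (auto simp: covector_flow_def osc_adjoint_def power2_eq_square field_simps intro!: derivative_eq_intros)
  then show "((\<lambda>x. covector_flow \<omega> x p \<bullet> b) has_derivative
      (\<lambda>x. (x *\<^sub>R osc_adjoint \<omega> (covector_flow \<omega> s p)) \<bullet> b)) (at s)"
    by (simp add: b inner_axis has_field_derivative_def mult_commute_abs)
qed

lemma continuous_on_osc_adjoint_covector_flow: "continuous_on S (\<lambda>s. osc_adjoint \<omega> (covector_flow \<omega> s p))"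
  unfolding osc_adjoint_def covector_flow_def vec_lambda_beta fst_conv snd_conv by (intro continuous_intros)

lemma integral_time_reversal:
  fixes f :: "real \<Rightarrow> real"
  assumes "continuous_on UNIV f"
  shows "integral {a..b} (\<lambda>t. f (b - t)) = integral {0..b - a} f"
proof -
  have "f integrable_on {0..b - a}"
    by (rule integrable_continuous_interval[OF continuous_on_subset[OF assms]]) auto
  then have "(f has_integral integral {0..b - a} f) (cbox 0 (b - a))" by (simp add: integrable_integral)
  from has_integral_affinity[OF this, of "-1" b]
  have "((\<lambda>t. f (b - t)) has_integral integral {0..b - a} f) ((\<lambda>t. b - t) ` {0..b - a})"
    by simp
  then show ?thesis by (simp add: image_diff_atLeastAtMost integral_unique)
qed

context oscillators begin

lemma covector_flow_add: "covector_flow \<omega> s (covector_flow \<omega> t p) = covector_flow \<omega> (s + t) p"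
proof -
  have "\<omega> $ i \<noteq> 0" for i using pos[of i] by simp
  then show ?thesis
    by (simp add: covector_flow_def vec_eq_iff distrib_left cos_add sin_add field_simps)
qed

lemma H_covector_flow: "H (covector_flow \<omega> s p) = H p"
proof -
  have "amplitude \<omega> (covector_flow \<omega> s p) i = amplitude \<omega> p i" for i
  proof -
    have nz: "\<omega> $ i \<noteq> 0" using pos[of i] by simp
    let ?c = "cos (\<omega> $ i * s)" and ?s = "sin (\<omega> $ i * s)" and ?\<xi> = "fst (p $ i) / \<omega> $ i" and ?\<eta> = "snd (p $ i)"
    have "(fst (covector_flow \<omega> s p $ i))\<^sup>2 / (\<omega> $ i)\<^sup>2 = (?\<xi> * ?c - ?\<eta> * ?s)\<^sup>2"
      using nz by (simp add: covector_flow_def power_divide[symmetric] diff_divide_distrib)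
    moreover have "snd (covector_flow \<omega> s p $ i) = ?\<eta> * ?c + ?\<xi> * ?s"
      by (simp add: covector_flow_def)
    moreover have "(?\<eta> * ?c + ?\<xi> * ?s)\<^sup>2 + (?\<xi> * ?c - ?\<eta> * ?s)\<^sup>2 = ?\<eta>\<^sup>2 + ?\<xi>\<^sup>2"
    proof -
      have "(\<eta> * c + \<xi> * s)\<^sup>2 + (\<xi> * c - \<eta> * s)\<^sup>2 = (\<eta>\<^sup>2 + \<xi>\<^sup>2) * (s\<^sup>2 + c\<^sup>2)" for \<eta> \<xi> c s :: real
        by algebra
      then show ?thesis by (simp only: sin_cos_squared_add mult_1_right)
    qed
    ultimately show ?thesis by (simp add: amplitude_def power_divide)
  qed
  then show ?thesis by (simp add: torus_H_def)
qed

lemma dual_norm_state_flow: "\<rho> (state_flow \<omega> s x) = \<rho> x"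
proof (rule antisym)
  show "\<rho> (state_flow \<omega> s x) \<le> \<rho> x"
    unfolding dual_norm_eq[of "state_flow \<omega> s x"] inner_state_flow
    by (rule inner_le_dual_norm) (simp add: H_covector_flow maximiser)
  have "x \<bullet> maximiser x = state_flow \<omega> s x \<bullet> covector_flow \<omega> (- s) (maximiser x)"
    by (simp add: inner_state_flow covector_flow_add covector_flow_0)
  also have "\<dots> \<le> \<rho> (state_flow \<omega> s x)"
    by (rule inner_le_dual_norm) (simp add: H_covector_flow maximiser)
  finally show "\<rho> x \<le> \<rho> (state_flow \<omega> s x)" by (simp add: dual_norm_eq[of x])
qed

lemma maximiser_state_flow:
  assumes "x \<noteq> 0"
  shows "maximiser (state_flow \<omega> s x) = covector_flow \<omega> (- s) (maximiser x)"
proof (rule maximiser_unique)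
  show "state_flow \<omega> s x \<noteq> 0"
    using dual_norm_state_flow[of s x] dual_norm_pos[OF assms] dual_norm_eq[of 0] by auto
  show "H (covector_flow \<omega> (- s) (maximiser x)) \<le> 1"
    by (simp add: H_covector_flow maximiser)
  show "state_flow \<omega> s x \<bullet> covector_flow \<omega> (- s) (maximiser x) = \<rho> (state_flow \<omega> s x)"
    by (simp add: inner_state_flow covector_flow_add covector_flow_0 dual_norm_state_flow dual_norm_eq[of x])
qed

section \<open>Decrease of the dual norm along motions\<close>

text \<open>The central estimate: along \<open>x' = A x + v B\<close> the pairing \<open>\<langle>x(t), exp((c - t) A*) p\<rangle>\<close> has derivative
  \<open>v \<langle>B, exp((c - t) A*) p\<rangle>\<close>, because the contributions of \<open>A\<close> cancel.\<close>

lemma pairing_increment_ge: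
  assumes ac: "abs_continuous_on {a..b} x" and "a \<le> b" and g: "continuous_on UNIV g"
    and ae: "AE t in lebesgue. t \<in> {a..b} \<longrightarrow>
      (\<exists>v. (x has_vector_derivative (osc_A \<omega> (x t) + v *\<^sub>R osc_B)) (at t) \<and>
           g t \<le> v * torus_form \<omega> p ((c - t) *\<^sub>R \<omega>))"
  shows "integral {a..b} g \<le> x b \<bullet> covector_flow \<omega> (c - b) p - x a \<bullet> covector_flow \<omega> (c - a) p"
proof -
  define q where "q t = covector_flow \<omega> (c - t) p" for t
  have q: "(q has_vector_derivative - osc_adjoint \<omega> (q t)) (at t)" for t
  proof -
    have "((\<lambda>t. c - t) has_vector_derivative -1) (at t)"
      by (auto intro!: derivative_eq_intros)
    from vector_diff_chain_at[OF this has_vector_derivative_covector_flow[of \<omega> p "c - t"]] pos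
    show ?thesis by (simp add: q_def[abs_def] o_def)
  qed
  have "abs_continuous_on {a..b} (\<lambda>t. x t \<bullet> q t)"
  proof (rule abs_continuous_on_inner[OF ac, where g' = "\<lambda>t. - osc_adjoint \<omega> (q t)"])
    show "continuous_on {a..b} (\<lambda>t. - osc_adjoint \<omega> (q t))"
      unfolding q_def
      by (intro continuous_intros continuous_on_compose2[OF continuous_on_osc_adjoint_covector_flow[of UNIV]]) auto
  qed (use q has_vector_derivative_at_within in blast)
  then have "integral {a..b} g \<le> x b \<bullet> q b - x a \<bullet> q a"
  proof (rule abs_continuous_on_integral_le[OF _ \<open>a \<le> b\<close> g])
    show "AE t in lebesgue. t \<in> {a..b} \<longrightarrow> (\<exists>d\<ge>g t. ((\<lambda>t. x t \<bullet> q t) has_real_derivative d) (at t))"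
      using ae
    proof (rule AE_mp, intro AE_I2 impI)
      fix t assume "t \<in> {a..b} \<longrightarrow> (\<exists>v. (x has_vector_derivative (osc_A \<omega> (x t) + v *\<^sub>R osc_B)) (at t) \<and>
           g t \<le> v * torus_form \<omega> p ((c - t) *\<^sub>R \<omega>))" "t \<in> {a..b}"
      then obtain v where v: "(x has_vector_derivative (osc_A \<omega> (x t) + v *\<^sub>R osc_B)) (at t)"
        "g t \<le> v * torus_form \<omega> p ((c - t) *\<^sub>R \<omega>)" by blast
      have "((\<lambda>t. x t \<bullet> q t) has_vector_derivative
          (x t \<bullet> (- osc_adjoint \<omega> (q t)) + (osc_A \<omega> (x t) + v *\<^sub>R osc_B) \<bullet> q t)) (at t)"
        by (rule bounded_bilinear.has_vector_derivative[OF bounded_bilinear_inner v(1) q])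
      moreover have "x t \<bullet> (- osc_adjoint \<omega> (q t)) + (osc_A \<omega> (x t) + v *\<^sub>R osc_B) \<bullet> q t
          = v * torus_form \<omega> p ((c - t) *\<^sub>R \<omega>)"
        by (simp add: inner_add_left inner_osc_A q_def inner_osc_B_covector_flow)
      ultimately show "\<exists>d\<ge>g t. ((\<lambda>t. x t \<bullet> q t) has_real_derivative d) (at t)"
        using v(2) by (auto simp: has_real_derivative_iff_has_vector_derivative)
    qed
  qed
  then show ?thesis by (simp add: q_def)
qed

lemma continuous_on_torus_form_reversed:
  "continuous_on S (\<lambda>t. torus_form \<omega> p ((c - t) *\<^sub>R \<omega>))"
  by (rule continuous_on_compose2[OF continuous_on_torus_form[of UNIV]]) (auto intro!: continuous_intros)

lemma integral_abs_torus_form_reversed: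
  assumes "a < b"
  shows "integral {a..b} (\<lambda>t. \<bar>torus_form \<omega> p ((b - t) *\<^sub>R \<omega>)\<bar>) = (b - a) * time_average \<omega> (b - a) p"
  using assms integral_time_reversal[of "\<lambda>s. \<bar>torus_form \<omega> p (s *\<^sub>R \<omega>)\<bar>" a b]
  by (simp add: time_average_def torus_form_line_continuous continuous_on_rabs)

text \<open>Motions of the control system on \<open>[a, b]\<close> whose control values lie in \<open>[-1, 1]\<close>. The control is
  not required to be measurable, so motions under the basic control are covered without a selection
  argument.\<close>

definition driven :: "real \<Rightarrow> real \<Rightarrow> (real \<Rightarrow> 'n phase) \<Rightarrow> bool" where
  "driven a b x \<longleftrightarrow> abs_continuous_on {a..b} x \<and>
     (AE t in lebesgue. t \<in> {a..b} \<longrightarrow>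
        (\<exists>v. \<bar>v\<bar> \<le> 1 \<and> (x has_vector_derivative (osc_A \<omega> (x t) + v *\<^sub>R osc_B)) (at t)))"

lemma driven_subinterval:
  assumes "driven a b x" "{c..d} \<subseteq> {a..b}" shows "driven c d x"
  unfolding driven_def
proof
  show "abs_continuous_on {c..d} x"
    using assms abs_continuous_on_subset unfolding driven_def by blast
  show "AE t in lebesgue. t \<in> {c..d} \<longrightarrow> 
        (\<exists>v. \<bar>v\<bar> \<le> 1 \<and> (x has_vector_derivative (osc_A \<omega> (x t) + v *\<^sub>R osc_B)) (at t))"
    using assms(1)[unfolded driven_def, THEN conjunct2]
    by (rule eventually_mono) (use assms(2) in blast)
qed

lemma driven_pairing_increment_ge:
  assumes "driven a b x" "a \<le> b"
  shows "- integral {a..b} (\<lambda>t. \<bar>torus_form \<omega> p ((c - t) *\<^sub>R \<omega>)\<bar>)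
    \<le> x b \<bullet> covector_flow \<omega> (c - b) p - x a \<bullet> covector_flow \<omega> (c - a) p"
proof -
  have "integral {a..b} (\<lambda>t. - \<bar>torus_form \<omega> p ((c - t) *\<^sub>R \<omega>)\<bar>)
    \<le> x b \<bullet> covector_flow \<omega> (c - b) p - x a \<bullet> covector_flow \<omega> (c - a) p"
  proof (rule pairing_increment_ge[OF _ \<open>a \<le> b\<close>])
    show "abs_continuous_on {a..b} x" using assms(1) by (simp add: driven_def)
    show "continuous_on UNIV (\<lambda>t. - \<bar>torus_form \<omega> p ((c - t) *\<^sub>R \<omega>)\<bar>)"
      by (intro continuous_intros continuous_on_torus_form_reversed)
    have "AE t in lebesgue. t \<in> {a..b} \<longrightarrow>
        (\<exists>v. \<bar>v\<bar> \<le> 1 \<and> (x has_vector_derivative (osc_A \<omega> (x t) + v *\<^sub>R osc_B)) (at t))"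
      using assms(1) by (simp add: driven_def)
    then show "AE t in lebesgue. t \<in> {a..b} \<longrightarrow>
      (\<exists>v. (x has_vector_derivative (osc_A \<omega> (x t) + v *\<^sub>R osc_B)) (at t) \<and>
           - \<bar>torus_form \<omega> p ((c - t) *\<^sub>R \<omega>)\<bar> \<le> v * torus_form \<omega> p ((c - t) *\<^sub>R \<omega>))"
    proof (rule AE_mp, intro AE_I2 impI)
      fix t assume "t \<in> {a..b} \<longrightarrow>
        (\<exists>v. \<bar>v\<bar> \<le> 1 \<and> (x has_vector_derivative (osc_A \<omega> (x t) + v *\<^sub>R osc_B)) (at t))" "t \<in> {a..b}"
      then obtain v where v: "\<bar>v\<bar> \<le> 1" "(x has_vector_derivative (osc_A \<omega> (x t) + v *\<^sub>R osc_B)) (at t)"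
        by blast
      have "\<bar>v * torus_form \<omega> p ((c - t) *\<^sub>R \<omega>)\<bar> \<le> 1 * \<bar>torus_form \<omega> p ((c - t) *\<^sub>R \<omega>)\<bar>"
        unfolding abs_mult using v(1) by (intro mult_right_mono) auto
      then show "\<exists>v. (x has_vector_derivative (osc_A \<omega> (x t) + v *\<^sub>R osc_B)) (at t) \<and>
           - \<bar>torus_form \<omega> p ((c - t) *\<^sub>R \<omega>)\<bar> \<le> v * torus_form \<omega> p ((c - t) *\<^sub>R \<omega>)"
        using v(2) by (intro exI[of _ v]) linarith
    qed
  qed
  then show ?thesis by simp
qed

text \<open>The covector \<open>p\<close> is the one that the adjoint flow carries in time \<open>T\<close> to the maximiser at \<open>x(0)\<close>.\<close>

lemma driven_dual_norm_decrease_le: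
  assumes x: "driven 0 T x" and "T > 0" and le: "\<And>p. H p \<le> 1 \<Longrightarrow> time_average \<omega> T p \<le> 1 + e"
  shows "\<rho> (x 0) - \<rho> (x T) \<le> T * (1 + e)"
proof -
  let ?p = "covector_flow \<omega> (- T) (maximiser (x 0))"
  have p: "H ?p \<le> 1" by (simp add: H_covector_flow maximiser)
  have "- (T * time_average \<omega> T ?p) \<le> x T \<bullet> ?p - x 0 \<bullet> covector_flow \<omega> T ?p"
    using driven_pairing_increment_ge[OF x, of ?p T] integral_abs_torus_form_reversed[of 0 T ?p] \<open>T > 0\<close>
    by (simp add: covector_flow_0)
  moreover have "x 0 \<bullet> covector_flow \<omega> T ?p = \<rho> (x 0)"
    by (simp add: covector_flow_add covector_flow_0 dual_norm_eq)
  moreover have "x T \<bullet> ?p \<le> \<rho> (x T)" by (rule inner_le_dual_norm[OF p])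
  moreover have "T * time_average \<omega> T ?p \<le> T * (1 + e)"
    using le[OF p] \<open>T > 0\<close> by simp
  ultimately show ?thesis by linarith
qed

text \<open>The deviation from the free motion through \<open>x(b)\<close> is estimated by pairing it with itself.\<close>

lemma driven_near_state_flow:
  assumes x: "driven s b x" and "s \<le> b"
  shows "norm (state_flow \<omega> (s - b) (x b) - x s) \<le> form_bound \<omega> * (b - s)"
proof -
  define d where "d = x s - state_flow \<omega> (s - b) (x b)"
  have "integral {s..b} (\<lambda>t. \<bar>torus_form \<omega> d ((s - t) *\<^sub>R \<omega>)\<bar>) \<le> integral {s..b} (\<lambda>t. form_bound \<omega> * norm d)"
    by (intro integral_le integrable_continuous_interval continuous_intros continuous_on_torus_form_reversed abs_torus_form_le)
  then have "- (form_bound \<omega> * norm d * (b - s)) \<le> x b \<bullet> covector_flow \<omega> (s - b) d - x s \<bullet> d"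
    using driven_pairing_increment_ge[OF x \<open>s \<le> b\<close>, of d s] \<open>s \<le> b\<close> by (simp add: covector_flow_0 mult_ac)
  also have "\<dots> = - (d \<bullet> d)"
    by (simp add: inner_state_flow[symmetric] d_def inner_diff_left)
  finally have "norm d * norm d \<le> norm d * (form_bound \<omega> * (b - s))"
    by (simp add: dot_square_norm power2_eq_square mult_ac)
  then have "norm d \<le> form_bound \<omega> * (b - s)"
    using form_bound_nonneg[of \<omega>] \<open>s \<le> b\<close> by (cases "d = 0") auto
  then show ?thesis by (simp add: d_def norm_minus_commute)
qed

text \<open>Motions under the basic control on an interval \<open>[a, b]\<close>.\<close>

definition steered :: "real \<Rightarrow> real \<Rightarrow> (real \<Rightarrow> 'n phase) \<Rightarrow> bool" where
  "steered a b x \<longleftrightarrow> abs_continuous_on {a..b} x \<and>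
     (AE t in lebesgue. t \<in> {a..b} \<longrightarrow>
        (\<exists>v \<in> basic_control \<omega> (x t). (x has_vector_derivative (osc_A \<omega> (x t) + v *\<^sub>R osc_B)) (at t)))"

lemma basic_control_le_1: "v \<in> basic_control \<omega> x \<Longrightarrow> \<bar>v\<bar> \<le> 1"
  by (auto simp: basic_control_def sign_set_def split: if_splits)

lemma basic_control_inner:
  assumes "v \<in> basic_control \<omega> x" "x \<noteq> 0"
  shows "v * (osc_B \<bullet> maximiser x) = - \<bar>osc_B \<bullet> maximiser x\<bar>"
  using assms by (auto simp: basic_control_def sign_set_def gradient_dual_norm split: if_splits)

lemma steered_imp_driven: "steered a b x \<Longrightarrow> driven a b x"
  unfolding steered_def driven_def
  by (elim conjE, intro conjI, assumption, erule eventually_mono) (use basic_control_le_1 in blast)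

lemma steered_subinterval:
  assumes "steered a b x" "{c..d} \<subseteq> {a..b}" shows "steered c d x"
  unfolding steered_def
proof
  show "abs_continuous_on {c..d} x"
    using assms abs_continuous_on_subset unfolding steered_def by blast
  show "AE t in lebesgue. t \<in> {c..d} \<longrightarrow> 
        (\<exists>v \<in> basic_control \<omega> (x t). (x has_vector_derivative (osc_A \<omega> (x t) + v *\<^sub>R osc_B)) (at t))"
    using assms(1)[unfolded steered_def, THEN conjunct2]
    by (rule eventually_mono) (use assms(2) in blast)
qed

text \<open>The hypothesis \<open>close\<close> says that the gradient along the motion follows the adjoint flow up to \<open>d\<close>;
  replacing one by the other twice costs \<open>2 \<parallel>B\<parallel> d\<close> per unit of time.\<close>

lemma steered_dual_norm_decrease_ge:
  assumes x: "steered a b x" and "a < b" and xb: "x b \<noteq> 0"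
    and close: "\<And>t. t \<in> {a..b} \<Longrightarrow> x t \<noteq> 0 \<and>
      norm (maximiser (x t) - covector_flow \<omega> (b - t) (maximiser (x b))) \<le> d"
  shows "(b - a) * (time_average \<omega> (b - a) (maximiser (x b)) - 2 * norm (osc_B :: 'n phase) * d) \<le> \<rho> (x a) - \<rho> (x b)"
proof -
  define p where "p = maximiser (x b)"
  define \<beta> where "\<beta> = norm (osc_B :: 'n phase)"
  let ?f = "\<lambda>t. torus_form \<omega> p ((b - t) *\<^sub>R \<omega>)"
  have "integral {a..b} (\<lambda>t. \<bar>?f t\<bar> - 2 * \<beta> * d)
    \<le> x b \<bullet> covector_flow \<omega> (b - b) (- p) - x a \<bullet> covector_flow \<omega> (b - a) (- p)"
  proof (rule pairing_increment_ge)
    show "abs_continuous_on {a..b} x" using x by (simp add: steered_def)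
    show "continuous_on UNIV (\<lambda>t. \<bar>?f t\<bar> - 2 * \<beta> * d)"
      by (intro continuous_intros continuous_on_torus_form_reversed)
    have "AE t in lebesgue. t \<in> {a..b} \<longrightarrow>
        (\<exists>v \<in> basic_control \<omega> (x t). (x has_vector_derivative (osc_A \<omega> (x t) + v *\<^sub>R osc_B)) (at t))"
      using x by (simp add: steered_def)
    then show "AE t in lebesgue. t \<in> {a..b} \<longrightarrow>
      (\<exists>v. (x has_vector_derivative (osc_A \<omega> (x t) + v *\<^sub>R osc_B)) (at t) \<and>
           \<bar>?f t\<bar> - 2 * \<beta> * d \<le> v * torus_form \<omega> (- p) ((b - t) *\<^sub>R \<omega>))"
    proof (rule AE_mp, intro AE_I2 impI)
      fix t assume "t \<in> {a..b} \<longrightarrow>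
        (\<exists>v \<in> basic_control \<omega> (x t). (x has_vector_derivative (osc_A \<omega> (x t) + v *\<^sub>R osc_B)) (at t))"
        and t: "t \<in> {a..b}"
      then obtain v where v: "v \<in> basic_control \<omega> (x t)"
        "(x has_vector_derivative (osc_A \<omega> (x t) + v *\<^sub>R osc_B)) (at t)" by blast
      define h where "h = osc_B \<bullet> maximiser (x t)"
      have "h - ?f t = osc_B \<bullet> (maximiser (x t) - covector_flow \<omega> (b - t) p)"
        by (simp add: h_def inner_diff_right inner_osc_B_covector_flow)
      also have "\<bar>\<dots>\<bar> \<le> \<beta> * d"
        unfolding \<beta>_def using close[OF t]
        by (intro order_trans[OF Cauchy_Schwarz_ineq2] mult_left_mono) (auto simp: p_def)
      finally have hf: "\<bar>h - ?f t\<bar> \<le> \<beta> * d" .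
      have vh: "v * h = - \<bar>h\<bar>"
        unfolding h_def using basic_control_inner[OF v(1)] close[OF t] by blast
      have "\<bar>v * (h - ?f t)\<bar> \<le> 1 * (\<beta> * d)"
        unfolding abs_mult using basic_control_le_1[OF v(1)] hf by (intro mult_mono) auto
      then have "v * h - v * ?f t \<ge> - (\<beta> * d)" by (simp add: right_diff_distrib abs_le_iff)
      then have "\<bar>?f t\<bar> - 2 * \<beta> * d \<le> - (v * ?f t)" using vh hf by linarith
      then show "\<exists>v. (x has_vector_derivative (osc_A \<omega> (x t) + v *\<^sub>R osc_B)) (at t) \<and>
           \<bar>?f t\<bar> - 2 * \<beta> * d \<le> v * torus_form \<omega> (- p) ((b - t) *\<^sub>R \<omega>)"
        using v(2) by (auto simp: torus_form_minus)
    qed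
  qed (use \<open>a < b\<close> in simp)
  also have "\<dots> = x a \<bullet> covector_flow \<omega> (b - a) p - \<rho> (x b)"
    by (simp add: covector_flow_minus covector_flow_0 p_def dual_norm_eq)
  also have "\<dots> \<le> \<rho> (x a) - \<rho> (x b)"
    using inner_le_dual_norm[of "covector_flow \<omega> (b - a) p" "x a"] by (simp add: H_covector_flow p_def maximiser)
  finally have "integral {a..b} (\<lambda>t. \<bar>?f t\<bar> - 2 * \<beta> * d) \<le> \<rho> (x a) - \<rho> (x b)" .
  moreover have "integral {a..b} (\<lambda>t. \<bar>?f t\<bar> - 2 * \<beta> * d) = integral {a..b} (\<lambda>t. \<bar>?f t\<bar>) - integral {a..b} (\<lambda>t. 2 * \<beta> * d)"
    by (intro Henstock_Kurzweil_Integration.integral_diff integrable_continuous_interval continuous_intros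
        continuous_on_torus_form_reversed)
  ultimately show ?thesis
    using \<open>a < b\<close> integral_abs_torus_form_reversed[OF \<open>a < b\<close>, of p]
    by (simp add: p_def[symmetric] \<beta>_def[symmetric] algebra_simps)
qed

text \<open>Largeness of \<open>\<rho>\<close> is only required at the right end of the window.\<close>

lemma steered_window_decrease_ge:
  assumes nonres: "nonresonant \<omega>" and "e > 0"
  obtains L0 M where "L0 > 0"
    "\<And>x a b. steered a b x \<Longrightarrow> L0 \<le> b - a \<Longrightarrow> b - a \<le> 2 * L0 \<Longrightarrow> \<rho> (x b) \<ge> M \<Longrightarrow>
       (b - a) * (1 - e) \<le> \<rho> (x a) - \<rho> (x b)"
proof -
  obtain R where R: "R > 0" "\<And>p. H p \<le> 1 \<Longrightarrow> norm p \<le> R" by (rule H_unit_ball_bounded) blast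
  obtain S where S: "S > 0" "\<And>x. \<rho> x \<le> S * norm x" by (rule dual_norm_le_norm) blast
  obtain L0 where L0: "L0 > 0" "\<And>L p. L \<ge> L0 \<Longrightarrow> norm p \<le> R \<Longrightarrow> \<bar>time_average \<omega> L p - H p\<bar> \<le> e / 2"
    by (rule time_average_uniform_limit[OF nonres half_gt_zero[OF \<open>e > 0\<close>], of R]) blast
  define \<beta> where "\<beta> = norm (osc_B :: 'n phase) + 1"
  have \<beta>: "\<beta> > 0" by (simp add: \<beta>_def add_nonneg_pos)
  \<comment> \<open>half of \<open>e\<close> goes to the time average, half to the variation of the gradient\<close>
  define d where "d = e / (4 * \<beta>)"
  have d: "d > 0" using \<beta> \<open>e > 0\<close> by (simp add: d_def)
  have "norm (osc_B :: 'n phase) * d \<le> \<beta> * d" using d by (intro mult_right_mono) (auto simp: \<beta>_def)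
  also have "\<beta> * d = e / 4" using \<beta> by (simp add: d_def)
  finally have \<beta>d: "2 * norm (osc_B :: 'n phase) * d \<le> e / 2" by simp
  \<comment> \<open>bounds the deviation from the free motion over a window of length at most \<open>2 L0\<close>\<close>
  define D where "D = form_bound \<omega> * (2 * L0)"
  have D: "D \<ge> 0" using form_bound_nonneg[of \<omega>] L0(1) by (simp add: D_def)
  obtain Q where Q: "Q > 0"
    "\<And>x y. norm x \<ge> Q \<Longrightarrow> norm (x - y) \<le> D \<Longrightarrow> y \<noteq> 0 \<and> norm (maximiser x - maximiser y) < d"
    by (rule maximiser_uniformly_close[OF d D]) blast
  show thesis
  proof (rule that[OF L0(1)])
    fix x a b assume x: "steered a b x" and L: "L0 \<le> b - a" "b - a \<le> 2 * L0" and M: "\<rho> (x b) \<ge> S * Q"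
    have ab: "a < b" using L L0(1) by simp
    have large: "norm y \<ge> Q" if "\<rho> y \<ge> S * Q" for y
      using order_trans[OF that S(2)] S(1) by simp
    have xb: "x b \<noteq> 0" using large[OF M] Q(1) by auto
    have "(b - a) * (1 - e) \<le> (b - a) * (time_average \<omega> (b - a) (maximiser (x b)) - 2 * norm (osc_B :: 'n phase) * d)"
    proof (rule mult_left_mono)
      have "H (maximiser (x b)) = 1"
        by (rule H_maximiser[OF xb]) (auto simp: maximiser dual_norm_eq)
      then show "1 - e \<le> time_average \<omega> (b - a) (maximiser (x b)) - 2 * norm (osc_B :: 'n phase) * d"
        using L0(2)[OF L(1) R(2)[OF maximiser(1)], of "x b"] \<beta>d by linarith
    qed (use ab in simp)
    also have "\<dots> \<le> \<rho> (x a) - \<rho> (x b)"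
    proof (rule steered_dual_norm_decrease_ge[OF x ab xb])
      fix t assume t: "t \<in> {a..b}"
      define y where "y = state_flow \<omega> (t - b) (x b)"
      have "norm (y - x t) \<le> form_bound \<omega> * (b - t)"
        unfolding y_def
        by (rule driven_near_state_flow[OF driven_subinterval[OF steered_imp_driven[OF x]]]) (use t in auto)
      also have "\<dots> \<le> D"
        unfolding D_def using t L form_bound_nonneg[of \<omega>] by (intro mult_left_mono) auto
      finally have "norm (y - x t) \<le> D" .
      moreover have "norm y \<ge> Q" using M by (intro large) (simp add: y_def dual_norm_state_flow)
      ultimately have "x t \<noteq> 0 \<and> norm (maximiser y - maximiser (x t)) < d" by (intro Q(2))
      moreover have "maximiser y = covector_flow \<omega> (b - t) (maximiser (x b))"
        unfolding y_def by (simp add: maximiser_state_flow[OF xb])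
      ultimately show "x t \<noteq> 0 \<and> norm (maximiser (x t) - covector_flow \<omega> (b - t) (maximiser (x b))) \<le> d"
        by (simp add: norm_minus_commute)
    qed
    finally show "(b - a) * (1 - e) \<le> \<rho> (x a) - \<rho> (x b)" .
  qed
qed

text \<open>The interval is divided into \<open>\<lfloor>T / L0\<rfloor>\<close> windows of equal length, which lies between \<open>L0\<close> and \<open>2 L0\<close>.
  Backward induction on the windows propagates \<open>\<rho> \<ge> M\<close> from \<open>T\<close> to all window ends.\<close>

lemma steered_decrease_ge:
  assumes nonres: "nonresonant \<omega>" and "e > 0" "e \<le> 1"
  obtains M where "\<And>x T. steered 0 T x \<Longrightarrow> T \<ge> M \<Longrightarrow> \<rho> (x T) \<ge> M \<Longrightarrow> T * (1 - e) \<le> \<rho> (x 0) - \<rho> (x T)"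
proof -
  obtain L0 M where L0: "L0 > 0"
    "\<And>x a b. steered a b x \<Longrightarrow> L0 \<le> b - a \<Longrightarrow> b - a \<le> 2 * L0 \<Longrightarrow> \<rho> (x b) \<ge> M \<Longrightarrow>
       (b - a) * (1 - e) \<le> \<rho> (x a) - \<rho> (x b)"
    by (rule steered_window_decrease_ge[OF nonres \<open>e > 0\<close>]) blast
  show thesis
  proof (rule that[of "max L0 M"])
    fix x T assume x: "steered 0 T x" and T: "T \<ge> max L0 M" and M: "\<rho> (x T) \<ge> max L0 M"
    define n where "n = nat \<lfloor>T / L0\<rfloor>"
    define L where "L = T / real n"
    have TL: "T / L0 \<ge> 1" using T L0(1) by simp
    then have n: "real n \<le> T / L0" "T / L0 < real n + 1" "n \<ge> 1"
      unfolding n_def by (simp_all add: le_nat_floor)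
    have nL: "real n * L = T" using n(3) by (simp add: L_def)
    have "L0 \<le> L" using n(1,3) L0(1) by (simp add: L_def field_simps)
    have "T \<le> 2 * L0 * real n"
    proof -
      have "T / L0 \<le> 2 * real n" using n(2,3) by linarith
      then show ?thesis using L0(1) by (simp add: field_simps)
    qed
    then have "L \<le> 2 * L0" using n(3) by (simp add: L_def field_simps)
    have "real k * L * (1 - e) \<le> \<rho> (x (T - real k * L)) - \<rho> (x T)" if "k \<le> n" for k
      using that
    proof (induction k)
      case (Suc k)
      let ?a = "T - real (Suc k) * L" and ?b = "T - real k * L"
      have IH: "real k * L * (1 - e) \<le> \<rho> (x ?b) - \<rho> (x T)" using Suc by simp
      have "real (Suc k) * L \<le> real n * L"
        using Suc.prems L0(1) \<open>L0 \<le> L\<close> by (intro mult_right_mono) auto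
      then have sub: "{?a..?b} \<subseteq> {0..T}"
        using nL L0(1) \<open>L0 \<le> L\<close> by auto
      have ba: "?b - ?a = L" by (simp add: algebra_simps)
      have "real k * L * (1 - e) \<ge> 0" using L0(1) \<open>L0 \<le> L\<close> \<open>e \<le> 1\<close> by simp
      then have "\<rho> (x ?b) \<ge> M" using IH M by linarith
      from L0(2)[OF steered_subinterval[OF x sub] _ _ this]
      have "L * (1 - e) \<le> \<rho> (x ?a) - \<rho> (x ?b)" unfolding ba using \<open>L0 \<le> L\<close> \<open>L \<le> 2 * L0\<close> by blast
      moreover have "real (Suc k) * L * (1 - e) = real k * L * (1 - e) + L * (1 - e)" by (simp add: algebra_simps)
      ultimately show ?case using IH by linarith
    qed simp
    from this[of n] show "T * (1 - e) \<le> \<rho> (x 0) - \<rho> (x T)" by (simp add: nL)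
  qed
qed

lemma driven_decrease_le:
  assumes nonres: "nonresonant \<omega>" and "e > 0"
  obtains M where "\<And>x T. driven 0 T x \<Longrightarrow> T > 0 \<Longrightarrow> T \<ge> M \<Longrightarrow> \<rho> (x 0) - \<rho> (x T) \<le> T * (1 + e)"
proof -
  obtain R where R: "R > 0" "\<And>p. H p \<le> 1 \<Longrightarrow> norm p \<le> R" by (rule H_unit_ball_bounded) blast
  obtain L0 where L0: "L0 > 0" "\<And>L p. L \<ge> L0 \<Longrightarrow> norm p \<le> R \<Longrightarrow> \<bar>time_average \<omega> L p - H p\<bar> \<le> e"
    by (rule time_average_uniform_limit[OF nonres \<open>e > 0\<close>, of R]) blast
  show thesis
  proof (rule that[of L0])
    fix x T assume x: "driven 0 T x" and T: "T > 0" "T \<ge> L0"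
    show "\<rho> (x 0) - \<rho> (x T) \<le> T * (1 + e)"
    proof (rule driven_dual_norm_decrease_le[OF x T(1)])
      fix p assume "H p \<le> 1"
      then show "time_average \<omega> T p \<le> 1 + e" using L0(2)[OF T(2) R(2), of p] by linarith
    qed
  qed
qed

end

theorem theorem5:
  fixes \<omega> :: "real ^ 'n::finite"
  assumes pos: "\<And>i. \<omega> $ i > 0"
    and distinct: "\<And>i j. i \<noteq> j \<Longrightarrow> \<omega> $ i \<noteq> \<omega> $ j"
    and nonres: "nonresonant \<omega>"
  shows "(\<forall>\<epsilon>>0. \<exists>M\<^sub>0. \<forall>T x.
            T > 0 \<and> basic_motion \<omega> T x \<and>
            min (dual_norm \<omega> (x 0)) (min (dual_norm \<omega> (x T)) T) \<ge> M\<^sub>0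
            \<longrightarrow> \<bar>(dual_norm \<omega> (x 0) - dual_norm \<omega> (x T)) / T - 1\<bar> < \<epsilon>) \<and>
         (\<forall>\<epsilon>>0. \<exists>M\<^sub>0. \<forall>T x u.
            T > 0 \<and> admissible_control T u \<and> controlled_motion \<omega> T u x \<and>
            min (dual_norm \<omega> (x 0)) (min (dual_norm \<omega> (x T)) T) \<ge> M\<^sub>0
            \<longrightarrow> (dual_norm \<omega> (x 0) - dual_norm \<omega> (x T)) / T \<le> 1 + \<epsilon>)"
proof -
  interpret oscillators \<omega> by unfold_locales (rule pos)
  have steered: "steered 0 T x" if "basic_motion \<omega> T x" for T x
    using that by (simp add: basic_motion_def steered_def)
  have driven: "driven 0 T x" if "admissible_control T u" "controlled_motion \<omega> T u x" for T u x
    unfolding driven_def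
  proof
    show "abs_continuous_on {0..T} x" using that(2) by (simp add: controlled_motion_def)
    have "AE t in lebesgue. t \<in> {0..T} \<longrightarrow> (x has_vector_derivative (osc_A \<omega> (x t) + u t *\<^sub>R osc_B)) (at t)"
      using that(2) by (simp only: controlled_motion_def)
    then show "AE t in lebesgue. t \<in> {0..T} \<longrightarrow>
        (\<exists>v. \<bar>v\<bar> \<le> 1 \<and> (x has_vector_derivative (osc_A \<omega> (x t) + v *\<^sub>R osc_B)) (at t))"
      by (rule eventually_mono) (use that(1) in \<open>unfold admissible_control_def, blast\<close>)
  qed
  show ?thesis
  proof (intro conjI allI impI)
    fix \<epsilon> :: real assume "\<epsilon> > 0"
    define e where "e = min (\<epsilon> / 2) 1"
    have e: "e > 0" "e \<le> 1" "e < \<epsilon>" using \<open>\<epsilon> > 0\<close> by (auto simp: e_def)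
    obtain M1 where M1: "\<And>x T. steered 0 T x \<Longrightarrow> T \<ge> M1 \<Longrightarrow> \<rho> (x T) \<ge> M1 \<Longrightarrow> T * (1 - e) \<le> \<rho> (x 0) - \<rho> (x T)"
      by (rule steered_decrease_ge[OF nonres e(1,2)]) blast
    obtain M2 where M2: "\<And>x T. driven 0 T x \<Longrightarrow> T > 0 \<Longrightarrow> T \<ge> M2 \<Longrightarrow> \<rho> (x 0) - \<rho> (x T) \<le> T * (1 + e)"
      by (rule driven_decrease_le[OF nonres e(1)]) blast
    show "\<exists>M\<^sub>0. \<forall>T x. T > 0 \<and> basic_motion \<omega> T x \<and> min (\<rho> (x 0)) (min (\<rho> (x T)) T) \<ge> M\<^sub>0
            \<longrightarrow> \<bar>(\<rho> (x 0) - \<rho> (x T)) / T - 1\<bar> < \<epsilon>"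
    proof (intro exI[of _ "max M1 M2"] allI impI)
      fix T x assume "T > 0 \<and> basic_motion \<omega> T x \<and> min (\<rho> (x 0)) (min (\<rho> (x T)) T) \<ge> max M1 M2"
      then have T: "T > 0" "T \<ge> M1" "T \<ge> M2" "\<rho> (x T) \<ge> M1" and x: "steered 0 T x"
        using steered by auto
      have "T * (1 - e) \<le> \<rho> (x 0) - \<rho> (x T)" "\<rho> (x 0) - \<rho> (x T) \<le> T * (1 + e)"
        using M1[OF x T(2,4)] M2[OF steered_imp_driven[OF x] T(1,3)] by auto
      then have "1 - e \<le> (\<rho> (x 0) - \<rho> (x T)) / T" "(\<rho> (x 0) - \<rho> (x T)) / T \<le> 1 + e"
        using T(1) by (simp_all add: field_simps)
      then show "\<bar>(\<rho> (x 0) - \<rho> (x T)) / T - 1\<bar> < \<epsilon>" using e(3) by linarith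
    qed
  next
    fix \<epsilon> :: real assume "\<epsilon> > 0"
    obtain M where M: "\<And>x T. driven 0 T x \<Longrightarrow> T > 0 \<Longrightarrow> T \<ge> M \<Longrightarrow> \<rho> (x 0) - \<rho> (x T) \<le> T * (1 + \<epsilon>)"
      by (rule driven_decrease_le[OF nonres \<open>\<epsilon> > 0\<close>]) blast
    show "\<exists>M\<^sub>0. \<forall>T x u. T > 0 \<and> admissible_control T u \<and> controlled_motion \<omega> T u x \<and>
            min (\<rho> (x 0)) (min (\<rho> (x T)) T) \<ge> M\<^sub>0 \<longrightarrow> (\<rho> (x 0) - \<rho> (x T)) / T \<le> 1 + \<epsilon>"
    proof (intro exI[of _ M] allI impI)
      fix T x u assume "T > 0 \<and> admissible_control T u \<and> controlled_motion \<omega> T u x \<and>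
            min (\<rho> (x 0)) (min (\<rho> (x T)) T) \<ge> M"
      then have "\<rho> (x 0) - \<rho> (x T) \<le> T * (1 + \<epsilon>)" "T > 0" using M driven by auto
      then show "(\<rho> (x 0) - \<rho> (x T)) / T \<le> 1 + \<epsilon>" by (simp add: field_simps)
    qed
  qed
qed

end
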